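(* Let $\ell=tp^n+k$ with integers $t\ge 0$, $1\le k\le p^n$, and suppose $\max(r+s-p^{n+1},0)+1\le\ell\le\min(r,s)$ and $\min(R,S)>0$. Assume that $R>S$, $S+1\le k\le R$, and $t\le\min(r_n,s_n-1)$. Then $\lambda_\ell=(r_n+s_n-2t)p^n$, so $(g-1)^{(r_n+s_n-2t-1)p^n}$ maps $D_{(r_n+s_n-t)p^n+R+S-k}$ to $D_{(t+1)p^n+R+S-k}$, and the following hold. (1) Define $z_\ell\in D_{(t+1)p^n+R+S-k}$ by \[z_\ell=(-1)^{R+S-k}\sum_{i=0}^t(-1)^i v_{ip^n+R+S+1-k,\,(t-i+1)p^n}.\] Then $(g-1)^{p^n-1}(z_\ell)=x_{tp^n+R+S+1-k}$. (2) Let $P$ be the $(t+1)\times(t+1)$ matrix over $F$ with $(i,j)$ entry $\binom{r_n+s_n-2t-1}{r_n-t+j-i}$ (which is invertible), let $X$ be the $(t+1)\times1$ matrix with $(i,1)$ entry $(-1)^{i-1}$, and let $\zeta=P^{-1}X$. Define $y_\ell\in D_{(r_n+s_n-t)p^n+R+S-k}$ by \[y_\ell=(-1)^{R+S-k}\sum_{i=0}^t\zeta_{i+1,1}\,v_{(r_n-t+i)p^n+R+S+1-k,\,(s_n-i)p^n}.\] Then $(g-1)^{(r_n+s_n-2t-1)p^n}(y_\ell)=z_\ell$.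
   Context: $p$ is a prime, $F$ a field of characteristic $p$, $G=\langle g\rangle$ a cyclic group of order $q=p^a$ ($a$ a positive integer). $V_q$ is the indecomposable $FG$-module of dimension $q$, with ordered $F$-basis $(v_1,\dots,v_q)$ such that $gv_1=v_1$ and $gv_i=v_{i-1}+v_i$ for $i>1$; $V_i=\langle v_1,\dots,v_i\rangle$, and $V_1,\dots,V_q$ is a complete set of indecomposable $FG$-modules. Let $1\le r,s\le q$ and write $V_r\otimes V_s\cong V_{\lambda_1}\oplus\dots\oplus V_{\lambda_{\min(r,s)}}$ with $\lambda_1\ge\dots\ge\lambda_{\min(r,s)}>0$. Let $n$ be the unique nonnegative integer with $p^n\le\max(r,s)<p^{n+1}$, and write $r=r_np^n+R$, $s=s_np^n+S$ with integers $0\le r_n,s_n<p$ and $0\le R,S<p^n$ (the paper writes $R_{n-1},S_{n-1}$). The elements $v_{i,j}=v_i\otimes g^{n-i}v_j$ ($1\le i\le r$, $1\le j\le s$) form a basis of $V_r\otimes V_s$ satisfying $(g-1)v_{i,j}=v_{i-1,j}+v_{i,j-1}$, with $v_{i,j}=0$ if $i\le0$ or $j\le0$. Put $D_d=\langle v_{i,j}\mid i+j=d+1\rangle$ for $1\le d\le r+s-1$ and $x_d=\sum_{i=1}^d(-1)^{i-1}v_{i,d+1-i}$ for $1\le d\le\min(r,s)$. Binomial coefficients $\binom cd$ are $0$ if $d<0$ or $d>c$, and are regarded as elements of $F$. *)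

theory Defs
  imports
    "HOL-Algebra.Generated_Groups"
    "HOL-Library.Function_Algebras"
    "HOL-Computational_Algebra.Computational_Algebra"
    "Jordan_Normal_Form.Gauss_Jordan_Elimination"
begin

(* Vector spaces are subspaces V of an ambient vector space with scalar multiplication sc,
   so linearity is only required on V. *)

definition linear_on_space ::
    "('f::field \<Rightarrow> 'v::ab_group_add \<Rightarrow> 'v) \<Rightarrow> 'v set \<Rightarrow>
     ('f \<Rightarrow> 'w::ab_group_add \<Rightarrow> 'w) \<Rightarrow> ('v \<Rightarrow> 'w) \<Rightarrow> bool" where
  "linear_on_space sc V sc' f \<longleftrightarrow>
     (\<forall>x\<in>V. \<forall>y\<in>V. f (x + y) = f x + f y) \<and> (\<forall>c. \<forall>x\<in>V. f (sc c x) = sc' c (f x))"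

definition bilinear_on_spaces ::
    "('f::field \<Rightarrow> 'v::ab_group_add \<Rightarrow> 'v) \<Rightarrow> 'v set \<Rightarrow>
     ('f \<Rightarrow> 'w::ab_group_add \<Rightarrow> 'w) \<Rightarrow> 'w set \<Rightarrow>
     ('f \<Rightarrow> 'u::ab_group_add \<Rightarrow> 'u) \<Rightarrow> ('v \<Rightarrow> 'w \<Rightarrow> 'u) \<Rightarrow> bool" where
  "bilinear_on_spaces scV V scW W scU B \<longleftrightarrow>
     (\<forall>x\<in>V. linear_on_space scW W scU (B x)) \<and>
     (\<forall>y\<in>W. linear_on_space scV V scU (\<lambda>x. B x y))"

definition FG_module ::
    "('g, 'c) monoid_scheme \<Rightarrow> ('f::field \<Rightarrow> 'v::ab_group_add \<Rightarrow> 'v) \<Rightarrow> 'v set \<Rightarrow>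
     ('g \<Rightarrow> 'v \<Rightarrow> 'v) \<Rightarrow> bool" where
  "FG_module G sc V act \<longleftrightarrow>
     group G \<and> vector_space sc \<and> module.subspace sc V \<and>
     (\<forall>h\<in>carrier G. (\<forall>x\<in>V. act h x \<in> V) \<and> linear_on_space sc V sc (act h)) \<and>
     (\<forall>x\<in>V. act \<one>\<^bsub>G\<^esub> x = x) \<and>
     (\<forall>h\<in>carrier G. \<forall>k\<in>carrier G. \<forall>x\<in>V. act (h \<otimes>\<^bsub>G\<^esub> k) x = act h (act k x))"

definition FG_isomorphic ::
    "('g, 'c) monoid_scheme \<Rightarrow>
     ('f::field \<Rightarrow> 'v::ab_group_add \<Rightarrow> 'v) \<Rightarrow> 'v set \<Rightarrow> ('g \<Rightarrow> 'v \<Rightarrow> 'v) \<Rightarrow>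
     ('f \<Rightarrow> 'w::ab_group_add \<Rightarrow> 'w) \<Rightarrow> 'w set \<Rightarrow> ('g \<Rightarrow> 'w \<Rightarrow> 'w) \<Rightarrow> bool" where
  "FG_isomorphic G scV V actV scW W actW \<longleftrightarrow>
     (\<exists>\<phi>. bij_betw \<phi> V W \<and> linear_on_space scV V scW \<phi> \<and>
          (\<forall>h\<in>carrier G. \<forall>x\<in>V. \<phi> (actV h x) = actW h (\<phi> x)))"

(* External direct sum M 1 + ... + M m. Operations on it are pointwise. *)

definition direct_sum :: "nat \<Rightarrow> (nat \<Rightarrow> 'v set) \<Rightarrow> (nat \<Rightarrow> 'v::zero) set" where
  "direct_sum m M = {f. (\<forall>i\<in>{1..m}. f i \<in> M i) \<and> (\<forall>i. i \<notin> {1..m} \<longrightarrow> f i = 0)}"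

(* Universal property of the tensor product of V and W. HOL cannot quantify over the type of the
   target space; over a field it is enough to require the property for the target F itself,
   because linear forms separate the points of the tensor product. *)

definition is_tensor_product ::
    "('f::field \<Rightarrow> 'v::ab_group_add \<Rightarrow> 'v) \<Rightarrow> 'v set \<Rightarrow>
     ('f \<Rightarrow> 'w::ab_group_add \<Rightarrow> 'w) \<Rightarrow> 'w set \<Rightarrow>
     ('f \<Rightarrow> 't::ab_group_add \<Rightarrow> 't) \<Rightarrow> 't set \<Rightarrow> ('v \<Rightarrow> 'w \<Rightarrow> 't) \<Rightarrow> bool" where
  "is_tensor_product scV V scW W scT T tens \<longleftrightarrow>
     vector_space scT \<and> module.subspace scT T \<and>
     (\<forall>x\<in>V. \<forall>y\<in>W. tens x y \<in> T) \<and>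
     bilinear_on_spaces scV V scW W scT tens \<and>
     (\<forall>B. bilinear_on_spaces scV V scW W (*) B \<longrightarrow>
       (\<exists>L. linear_on_space scT T (*) L \<and> (\<forall>x\<in>V. \<forall>y\<in>W. L (tens x y) = B x y) \<and>
         (\<forall>L'. linear_on_space scT T (*) L' \<and> (\<forall>x\<in>V. \<forall>y\<in>W. L' (tens x y) = B x y)
            \<longrightarrow> (\<forall>u\<in>T. L' u = L u))))"

definition V_sub ::
    "('f::field \<Rightarrow> 'v::ab_group_add \<Rightarrow> 'v) \<Rightarrow> (nat \<Rightarrow> 'v) \<Rightarrow> nat \<Rightarrow> 'v set" where
  "V_sub sc v i = module.span sc (v ` {1..i})"

definition is_Vq ::
    "('g, 'c) monoid_scheme \<Rightarrow> 'g \<Rightarrow> nat \<Rightarrow> ('f::field \<Rightarrow> 'v::ab_group_add \<Rightarrow> 'v) \<Rightarrow>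
     ('g \<Rightarrow> 'v \<Rightarrow> 'v) \<Rightarrow> (nat \<Rightarrow> 'v) \<Rightarrow> bool" where
  "is_Vq G g q sc act v \<longleftrightarrow>
     FG_module G sc (V_sub sc v q) act \<and>
     inj_on v {1..q} \<and> \<not> module.dependent sc (v ` {1..q}) \<and>
     act g (v 1) = v 1 \<and>
     (\<forall>i. 1 < i \<and> i \<le> q \<longrightarrow> act g (v i) = v (i - 1) + v i)"

(* (T, act', tens) is the tensor product module, with the diagonal action. *)

definition is_tensor_module ::
    "('g, 'c) monoid_scheme \<Rightarrow>
     ('f::field \<Rightarrow> 'v::ab_group_add \<Rightarrow> 'v) \<Rightarrow> ('g \<Rightarrow> 'v \<Rightarrow> 'v) \<Rightarrow> 'v set \<Rightarrow> 'v set \<Rightarrow>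
     ('f \<Rightarrow> 't::ab_group_add \<Rightarrow> 't) \<Rightarrow> ('g \<Rightarrow> 't \<Rightarrow> 't) \<Rightarrow> 't set \<Rightarrow> ('v \<Rightarrow> 'v \<Rightarrow> 't) \<Rightarrow> bool" where
  "is_tensor_module G sc act V W scT actT T tens \<longleftrightarrow>
     is_tensor_product sc V sc W scT T tens \<and> FG_module G scT T actT \<and>
     (\<forall>h\<in>carrier G. \<forall>x\<in>V. \<forall>y\<in>W. actT h (tens x y) = tens (act h x) (act h y))"

(* The exponent n - i may be negative, hence the integer power in G. *)

definition v_tensor ::
    "('g, 'c) monoid_scheme \<Rightarrow> 'g \<Rightarrow> nat \<Rightarrow> ('g \<Rightarrow> 'v \<Rightarrow> 'v) \<Rightarrow> (nat \<Rightarrow> 'v) \<Rightarrow>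
     ('v \<Rightarrow> 'v \<Rightarrow> 't::zero) \<Rightarrow> nat \<Rightarrow> nat \<Rightarrow> 't" where
  "v_tensor G g n act v tens i j =
     (if i = 0 \<or> j = 0 then 0 else tens (v i) (act (g [^]\<^bsub>G\<^esub> (int n - int i)) (v j)))"

definition D_space ::
    "('f::field \<Rightarrow> 't::ab_group_add \<Rightarrow> 't) \<Rightarrow> nat \<Rightarrow> nat \<Rightarrow> (nat \<Rightarrow> nat \<Rightarrow> 't) \<Rightarrow> nat \<Rightarrow> 't set" where
  "D_space sc r s w d =
     module.span sc {w i j | i j. 1 \<le> i \<and> i \<le> r \<and> 1 \<le> j \<and> j \<le> s \<and> i + j = d + 1}"

definition x_vec ::
    "('f::field \<Rightarrow> 't::ab_group_add \<Rightarrow> 't) \<Rightarrow> (nat \<Rightarrow> nat \<Rightarrow> 't) \<Rightarrow> nat \<Rightarrow> 't" where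
  "x_vec sc w d = (\<Sum>i=1..d. sc ((- 1) ^ (i - 1)) (w i (d + 1 - i)))"

(* (g - 1)^m *)

definition g_minus_1_pow ::
    "('g \<Rightarrow> 't::ab_group_add \<Rightarrow> 't) \<Rightarrow> 'g \<Rightarrow> nat \<Rightarrow> 't \<Rightarrow> 't" where
  "g_minus_1_pow act g m = (\<lambda>x. act g x - x) ^^ m"

definition binom_F :: "nat \<Rightarrow> int \<Rightarrow> 'f::field" where
  "binom_F c d = (if d < 0 then 0 else of_nat (c choose nat d))"

(* Matrix indices start at 0 here, which does not change the difference j - i. *)

definition P_mat :: "nat \<Rightarrow> nat \<Rightarrow> nat \<Rightarrow> 'f::field mat" where
  "P_mat rn sn t = mat (t + 1) (t + 1)
     (\<lambda>(i, j). binom_F (rn + sn - 2 * t - 1) (int rn - int t + int j - int i))"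

definition X_mat :: "nat \<Rightarrow> 'f::field mat" where
  "X_mat t = mat (t + 1) 1 (\<lambda>(i, j). (- 1) ^ i)"

definition zeta_mat :: "nat \<Rightarrow> nat \<Rightarrow> nat \<Rightarrow> 'f::field mat" where
  "zeta_mat rn sn t = the (mat_inverse (P_mat rn sn t)) * X_mat t"

end

theory Submission
  imports Defs "Jordan_Normal_Form.Determinant" "HOL-Algebra.Multiplicative_Group"
begin

text \<open>
  In the basis \<open>v\<^sub>i\<^sub>,\<^sub>j\<close> the map \<open>g - 1\<close> on \<open>V\<^sub>r \<otimes> V\<^sub>s\<close> is multiplication by \<open>x + y\<close> on
  \<open>F[x,y]/(x\<^sup>r,y\<^sup>s)\<close>. In characteristic \<open>p\<close> its \<open>p\<^sup>n\<close>-th power is \<open>x^(p^n) + y^(p^n)\<close>, and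
  its \<open>(p\<^sup>n - 1)\<close>-st power has all coefficients \<open>\<plusminus>1\<close>; comparing coordinates gives (1) and (2).
  The matrix \<open>P\<close> is invertible because a polynomial of degree less than \<open>p\<close> with at most \<open>c\<close> nonzero
  coefficients is not divisible by \<open>(1 + z)^c\<close> unless it vanishes. Finally, the number of \<open>i\<close> with
  \<open>\<lambda>\<^sub>i > m\<close> is the dimension of the intersection of the kernel of \<open>g - 1\<close> with the image of \<open>(g - 1)^m\<close>.
  The kernel is spanned by the \<open>x\<^sub>d\<close>: those with \<open>d \<le> tp\<^sup>n + R\<close> lie in the image of
  \<open>(g - 1)^((r\<^sub>n + s\<^sub>n - 2t)p\<^sup>n - 1)\<close> by (1) and (2), and those with \<open>d > tp\<^sup>n + S\<close> are outside the image
  of the next power because the matrix \<open>P\<close> for \<open>t - 1\<close> is invertible.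
\<close>

text \<open>The universal property in \<open>is_tensor_product\<close> speaks only of forms with
  values in F, so no basis of \<open>T\<close> is given at the outset. The coordinates
  \<open>Phi u i j\<close> come first, as linear forms, and vectors are compared through them. They
  vanish outside the box of size r times s, hence the formulas for powers of g - 1 need no boundary
  cases. The lower bound on \<open>l\<close> enters only as \<open>rn + sn - t < p\<close>, which
  keeps the degrees of the polynomials behind the matrices below p. The two thresholds have
  different origins. The vector y may have first index up to rn p^n + R, which is what lets the
  image reach index tp^n + R; second indices stop at sn p^n + S, which is what blocks the next power
  beyond tp^n + S. In between, \<open>lam\<close> is constant, and k affects only the choice of z
  and y. Dimensions of kernels and images are never formed: both bounds on \<open>lam\<close> use a
  nontrivial solution of a homogeneous system with more unknowns than equations.\<close>

section \<open>Sparse polynomials in characteristic p and invertibility of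
  \<open>P_mat\<close>\<close>

lemma of_nat_neq_0_less_char:
  assumes "0 < d" "d < CHAR('f::field)"
  shows "(of_nat d :: 'f) \<noteq> 0"
  using assms by (auto simp: of_nat_eq_0_iff_char_dvd dest: dvd_imp_le)

text \<open>Induction on \<open>c\<close> with the operator z d/dz - e, where e is the degree of
  \<open>h\<close>. It multiplies coefficient i by i - e, so the leading coefficient disappears,
  while divisibility drops by only one factor 1 + z. As the degree is below the characteristic, i -
  e is nonzero for i < e. So if the result is 0, then \<open>h\<close> is a monomial, and a nonzero
  monomial does not vanish at -1.\<close>

lemma sparse_poly_eq_0:
  fixes h :: "'f::field poly"
  assumes "degree h < CHAR('f)" "card {i. Polynomial.coeff h i \<noteq> 0} \<le> c" "[:1, 1:] ^ c dvd h"
  shows "h = 0"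
  using assms
proof (induction c arbitrary: h)
  case 0
  have "finite {i. Polynomial.coeff h i \<noteq> 0}"
    by (rule finite_subset[of _ "{..degree h}"]) (auto intro: le_degree)
  with 0 show ?case by (auto simp: poly_eq_iff)
next
  case (Suc c)
  show ?case
  proof (rule ccontr)
    assume "h \<noteq> 0"
    define e where "e = degree h"
    have fin: "finite {i. Polynomial.coeff h i \<noteq> 0}"
      by (rule finite_subset[of _ "{..degree h}"]) (auto intro: le_degree)
    define h' where "h' = [:0, 1:] * pderiv h - Polynomial.smult (of_nat e) h"
    have coeff_h': "Polynomial.coeff h' i = (of_nat i - of_nat e) * Polynomial.coeff h i" for i
      by (cases i) (auto simp: h'_def coeff_pderiv algebra_simps coeff_pCons)
    have "degree h' \<le> degree h"
      by (rule degree_le) (auto simp: coeff_h' coeff_eq_0)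
    moreover have "card {i. Polynomial.coeff h' i \<noteq> 0} \<le> c"
    proof -
      have "{i. Polynomial.coeff h' i \<noteq> 0} \<subseteq> {i. Polynomial.coeff h i \<noteq> 0} - {e}"
        by (auto simp: coeff_h')
      then have "card {i. Polynomial.coeff h' i \<noteq> 0} \<le> card ({i. Polynomial.coeff h i \<noteq> 0} - {e})"
        by (rule card_mono[rotated]) (use fin in auto)
      also have "\<dots> \<le> c"
        using Suc.prems(2) \<open>h \<noteq> 0\<close> fin by (subst card_Diff_singleton) (auto simp: e_def)
      finally show ?thesis .
    qed
    moreover have "[:1, 1:] ^ c dvd h'"
    proof -
      obtain k where k: "h = [:1, 1:] ^ Suc c * k" using Suc.prems(3) by (auto elim: dvdE)
      have "pderiv h = [:1, 1:] ^ c * ([:1, 1:] * pderiv k + Polynomial.smult (of_nat (Suc c)) k)"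
        unfolding k by (simp only: pderiv_mult pderiv_power_Suc) (simp add: pderiv_pCons algebra_simps smult_add_left)
      then have "[:1, 1:] ^ c dvd pderiv h" by (metis dvd_triv_left)
      moreover have "[:1, 1:] ^ c dvd h" unfolding k by (intro dvd_mult2) (simp only: power_Suc dvd_triv_right)
      ultimately show ?thesis
        unfolding h'_def by (intro dvd_diff dvd_mult dvd_smult)
    qed
    ultimately have "h' = 0" using Suc.IH[of h'] Suc.prems(1) by simp
    have "Polynomial.coeff h i = 0" if "i \<noteq> e" for i
    proof (cases "i < e")
      case True
      have "of_nat (e - i) \<noteq> (0::'f)"
        using True Suc.prems(1) by (intro of_nat_neq_0_less_char) (auto simp: e_def)
      then have "(of_nat i - of_nat e :: 'f) \<noteq> 0"
        using True by (simp add: of_nat_diff)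
      with coeff_h'[of i] \<open>h' = 0\<close> show ?thesis by simp
    next
      case False
      with that show ?thesis by (intro coeff_eq_0) (auto simp: e_def)
    qed
    then have "h = Polynomial.monom (lead_coeff h) e" by (auto simp: poly_eq_iff e_def)
    then have "poly h (-1) = lead_coeff h * (-1) ^ e" by (metis poly_monom)
    moreover have "[:1, 1:] dvd h" using Suc.prems(3) unfolding power_Suc by (rule dvd_mult_left)
    then have "poly h (-1) = 0" by (auto elim: dvdE)
    ultimately show False using \<open>h \<noteq> 0\<close> by simp
  qed
qed

lemma coeff_one_plus_X_power: "Polynomial.coeff ([:1, 1:] ^ c :: 'f::comm_ring_1 poly) i = of_nat (c choose i)"
proof -
  have "[:1, 1:] ^ c = (1 + Polynomial.monom 1 1 :: 'f poly) ^ c" by (simp add: monom_altdef one_pCons)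
  also have "\<dots> = (\<Sum>k\<le>c. of_nat (c choose k) * Polynomial.monom 1 k)"
    by (subst add.commute, subst binomial_ring) (simp add: monom_power)
  finally show ?thesis
    by (simp add: coeff_sum of_nat_poly coeff_monom if_distrib sum.delta binomial_eq_0 cong: if_cong)
qed

text \<open>Read \<open>f\<close> as a polynomial of degree less than \<open>m\<close>. The i-th
  equation says that coefficient b + i of (1 + z)^(a+b) times this polynomial is 0. The product then
  has nonzero coefficients only in degrees below b and in the a degrees from b + m on, at most a + b
  in all, and \<open>sparse_poly_eq_0\<close> applies with c = a + b.\<close>

lemma binomial_toeplitz_inj:
  fixes f :: "nat \<Rightarrow> 'f::field"
  assumes "a + b + m \<le> CHAR('f)"
    and eq0: "\<And>i. i < m \<Longrightarrow> (\<Sum>j<m. binom_F (a + b) (int a + int j - int i) * f j) = 0"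
    and "i < m"
  shows "f i = 0"
proof -
  define f0 where "f0 = (\<Sum>j<m. Polynomial.monom (f j) j)"
  have f0: "Polynomial.coeff f0 i = (if i < m then f i else 0)" for i
    by (simp add: f0_def coeff_sum if_distrib sum.delta cong: if_cong)
  have "degree f0 \<le> m - 1" by (rule degree_le) (auto simp: f0)
  define h where "h = [:1, 1:] ^ (a + b) * f0"
  have coeff_h: "Polynomial.coeff h (b + i) = 0" if "i < m" for i
  proof -
    have "Polynomial.coeff h (b + i) = (\<Sum>j\<le>b + i. Polynomial.coeff f0 j * of_nat ((a + b) choose (b + i - j)))"
      unfolding h_def by (subst mult.commute, subst coeff_mult) (simp add: coeff_one_plus_X_power)
    also have "\<dots> = (\<Sum>j\<in>{..<m} \<inter> {..b+i}. f j * of_nat ((a + b) choose (b + i - j)))"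
      by (rule sum.mono_neutral_cong_right) (auto simp: f0)
    also have "\<dots> = (\<Sum>j<m. binom_F (a + b) (int a + int j - int i) * f j)"
    proof (rule sum.mono_neutral_cong_left)
      show "\<forall>j\<in>{..<m} - {..<m} \<inter> {..b + i}. binom_F (a + b) (int a + int j - int i) * f j = 0"
      proof
        fix j assume j: "j \<in> {..<m} - {..<m} \<inter> {..b + i}"
        then have "nat (int a + int j - int i) > a + b" by auto
        then show "binom_F (a + b) (int a + int j - int i) * f j = 0"
          by (simp add: binom_F_def binomial_eq_0)
      qed
    next
      fix j assume j: "j \<in> {..<m} \<inter> {..b + i}"
      \<comment> \<open>Reflecting the binomial coefficient is possible only for i at most a + j.
        Beyond that, b + i - j exceeds a + b on one side and the lower index of
        \<open>binom_F\<close> is negative on the other, so both are 0.\<close>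
      have "(a + b choose (b + i - j)) = (a + b choose nat (int a + int j - int i))"
        if "int i \<le> int a + int j"
        using that j by (subst binomial_symmetric) (auto intro!: arg_cong[where f = "binomial _"])
      moreover have "(a + b choose (b + i - j)) = 0" if "int i > int a + int j"
        using that by (auto intro!: binomial_eq_0)
      moreover have "int i \<le> int a + int j \<longleftrightarrow> \<not> int a + int j - int i < 0" by linarith
      ultimately show "f j * of_nat ((a + b) choose (b + i - j)) = binom_F (a + b) (int a + int j - int i) * f j"
        by (cases "int i \<le> int a + int j") (simp_all add: binom_F_def binomial_eq_0)
    qed auto
    finally show ?thesis using eq0[OF that] by simp
  qed
  have deg: "degree h \<le> a + b + (m - 1)"
  proof -
    have "degree h \<le> degree ([:1, 1:] ^ (a + b) :: 'f poly) + degree f0"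
      unfolding h_def by (rule degree_mult_le)
    also have "degree ([:1, 1:] ^ (a + b) :: 'f poly) \<le> a + b"
      using degree_power_le[of "[:1, 1:] :: 'f poly" "a + b"] by simp
    finally show ?thesis using \<open>degree f0 \<le> m - 1\<close> by simp
  qed
  have "h = 0"
  proof (rule sparse_poly_eq_0)
    show "degree h < CHAR('f)" using deg assms(1,3) by simp
    show "[:1, 1:] ^ (a + b) dvd h" by (simp add: h_def)
    have "{i. Polynomial.coeff h i \<noteq> 0} \<subseteq> {..<b} \<union> {b + m..<b + m + a}"
    proof
      fix i assume i: "i \<in> {i. Polynomial.coeff h i \<noteq> 0}"
      then have "i \<le> a + b + (m - 1)" using deg le_degree[of h i] by auto
      moreover have "i < b \<or> i \<ge> b + m"
        using coeff_h[of "i - b"] i by (cases "i < b"; cases "i - b < m") auto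
      ultimately show "i \<in> {..<b} \<union> {b + m..<b + m + a}" using assms(3) by auto
    qed
    then have "card {i. Polynomial.coeff h i \<noteq> 0} \<le> card ({..<b} \<union> {b + m..<b + m + a})"
      by (intro card_mono) auto
    also have "\<dots> \<le> a + b"
      by (subst card_Un_disjoint) auto
    finally show "card {i. Polynomial.coeff h i \<noteq> 0} \<le> a + b" .
  qed
  then have "f0 = 0" by (simp add: h_def)
  with f0[of i] \<open>i < m\<close> show ?thesis by simp
qed

lemma P_mat_carrier: "P_mat rn sn t \<in> carrier_mat (t + 1) (t + 1)"
  by (simp add: P_mat_def)

text \<open>With a = rn - t and b = sn - 1 - t this is \<open>binomial_toeplitz_inj\<close> for m =
  t + 1; the sum a + b + m equals \<open>rn + sn - t\<close>.\<close>

lemma det_P_mat_neq_0: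
  assumes "t \<le> rn" "t < sn" "rn + sn - t \<le> CHAR('f::field)"
  shows "det (P_mat rn sn t :: 'f mat) \<noteq> 0"
proof
  assume "det (P_mat rn sn t :: 'f mat) = 0"
  then obtain x :: "'f vec" where x: "x \<in> carrier_vec (t + 1)" "x \<noteq> 0\<^sub>v (t + 1)"
    "P_mat rn sn t *\<^sub>v x = 0\<^sub>v (t + 1)"
    using det_0_iff_vec_prod_zero_field[OF P_mat_carrier] by blast
  define a b where "a = rn - t" and "b = sn - 1 - t"
  have ab: "rn + sn - 2 * t - 1 = a + b" "int rn - int t = int a" "a + b + (t + 1) \<le> CHAR('f)"
    using assms by (auto simp: a_def b_def)
  have eq0: "(\<Sum>j<t + 1. binom_F (a + b) (int a + int j - int i) * x $ j) = 0" if "i < t + 1" for i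
  proof -
    have "(P_mat rn sn t *\<^sub>v x) $ i = 0" using x that by simp
    then show ?thesis
      using x(1) that ab by (simp add: P_mat_def scalar_prod_def atLeast0LessThan carrier_vecD)
  qed
  then have "x $ i = 0" if "i < t + 1" for i
    by (rule binomial_toeplitz_inj[OF ab(3) _ that])
  with x(1,2) show False by auto
qed

lemma P_mat_inverse:
  assumes "t \<le> rn" "t < sn" "rn + sn - t \<le> CHAR('f::field)"
  obtains Q :: "'f::field mat" where "mat_inverse (P_mat rn sn t) = Some Q" "Q \<in> carrier_mat (t + 1) (t + 1)"
    "P_mat rn sn t * Q = 1\<^sub>m (t + 1)" "Q * P_mat rn sn t = 1\<^sub>m (t + 1)"
proof -
  have "P_mat rn sn t \<in> Units (ring_mat TYPE('f) (t + 1) ())"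
    by (rule det_non_zero_imp_unit[OF P_mat_carrier det_P_mat_neq_0[OF assms]])
  then have "mat_inverse (P_mat rn sn t :: 'f mat) \<noteq> None"
    using mat_inverse(1)[OF P_mat_carrier, of rn sn t "()"] by metis
  then obtain Q where Q: "mat_inverse (P_mat rn sn t :: 'f mat) = Some Q" by blast
  show ?thesis
    using that[OF Q] mat_inverse(2)[OF P_mat_carrier Q] by blast
qed

lemma P_mat_invertible:
  assumes "t \<le> rn" "t < sn" "rn + sn - t \<le> CHAR('f::field)"
  shows "invertible_mat (P_mat rn sn t :: 'f mat)"
proof -
  obtain Q :: "'f mat" where "Q \<in> carrier_mat (t + 1) (t + 1)"
    "P_mat rn sn t * Q = 1\<^sub>m (t + 1)" "Q * P_mat rn sn t = 1\<^sub>m (t + 1)"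
    using P_mat_inverse[OF assms] by blast
  then show ?thesis
    using P_mat_carrier[of rn sn t, where 'a = 'f]
    unfolding invertible_mat_def inverts_mat_def square_mat.simps by (metis carrier_matD)
qed

text \<open>Row i of P zeta = X, written as the sum that arises when a power of g - 1 is applied to
  y.\<close>

lemma P_mat_zeta:
  assumes "t \<le> rn" "t < sn" "rn + sn - t \<le> CHAR('f::field)" "i \<le> t"
  shows "(\<Sum>j\<le>t. binom_F (rn + sn - 2 * t - 1) (int rn - int t + int j - int i) * zeta_mat rn sn t $$ (j, 0))
    = ((- 1) ^ i :: 'f)"
proof -
  obtain Q :: "'f mat" where Q: "mat_inverse (P_mat rn sn t) = Some Q" "Q \<in> carrier_mat (t + 1) (t + 1)"
    "P_mat rn sn t * Q = 1\<^sub>m (t + 1)" using P_mat_inverse[OF assms(1-3)] by blast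
  have X: "(X_mat t :: 'f mat) \<in> carrier_mat (t + 1) 1" by (simp add: X_mat_def)
  have zc: "(zeta_mat rn sn t :: 'f mat) \<in> carrier_mat (t + 1) 1"
    using Q X by (simp add: zeta_mat_def)
  have "P_mat rn sn t * zeta_mat rn sn t = P_mat rn sn t * Q * X_mat t"
    unfolding zeta_mat_def Q(1) option.sel
    by (rule assoc_mult_mat[symmetric, OF P_mat_carrier Q(2) X])
  also have "\<dots> = X_mat t" unfolding Q(3) by (rule left_mult_one_mat[OF X])
  finally have "P_mat rn sn t * zeta_mat rn sn t = (X_mat t :: 'f mat)" .
  then have "(P_mat rn sn t * zeta_mat rn sn t) $$ (i, 0) = ((- 1) ^ i :: 'f)"
    using assms(4) by (simp add: X_mat_def)
  then show ?thesis
    using assms(4) carrier_matD[OF zc] by (simp add: P_mat_def scalar_prod_def atLeast0LessThan lessThan_Suc_atMost)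
qed

section \<open>Linear systems and binomial sums in characteristic p\<close>

text \<open>Zero rows pad the system to a square one; row \<open>m\<close> is then zero, so the
  determinant vanishes and a nonzero kernel vector exists. This takes the place of dimension
  counting in the bounds on \<open>lam\<close>.\<close>

lemma homogeneous_system_solvable:
  fixes b :: "nat \<Rightarrow> nat \<Rightarrow> 'f::field"
  assumes "m < l"
  obtains c where "\<exists>i<l. c i \<noteq> 0" "\<And>j. j < m \<Longrightarrow> (\<Sum>i<l. c i * b i j) = 0"
proof -
  define A where "A = mat l l (\<lambda>(j, i). if j < m then b i j else 0)"
  have A: "A \<in> carrier_mat l l" by (simp add: A_def)
  have "row A m = 0\<^sub>v l" using assms by (auto simp: A_def)
  then have "det A = 0"
    using laplace_expansion_row[OF A assms] assms by (simp add: A_def)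
  then obtain x where x: "x \<in> carrier_vec l" "x \<noteq> 0\<^sub>v l" "A *\<^sub>v x = 0\<^sub>v l"
    using det_0_iff_vec_prod_zero_field[OF A] by blast
  show ?thesis
  proof
    show "\<exists>i<l. x $ i \<noteq> 0" using x by auto
    fix j assume "j < m"
    moreover have "(A *\<^sub>v x) $ j = 0" using x(3) \<open>j < m\<close> assms by simp
    ultimately show "(\<Sum>i<l. x $ i * b i j) = 0"
      using x(1) assms by (simp add: A_def scalar_prod_def atLeast0LessThan carrier_vecD mult.commute)
  qed
qed

lemma char_power_binomial:
  assumes "prime p" "CHAR('f::field) = p" "0 < i" "i < p ^ n"
  shows "of_nat (p ^ n choose i) = (0::'f)"
proof -
  have "([:1, 1:] :: 'f poly) ^ (p ^ n) = (1 + Polynomial.monom 1 1) ^ p ^ n" by (simp add: monom_altdef one_pCons)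
  also have "\<dots> = 1 + Polynomial.monom 1 (p ^ n)"
    using assms(1,2) by (subst freshmans_dream') (auto simp: monom_power)
  finally have "Polynomial.coeff ([:1, 1:] ^ (p ^ n)) i = Polynomial.coeff (1 + Polynomial.monom 1 (p ^ n) :: 'f poly) i" by simp
  then show ?thesis using assms(3,4) by (simp add: coeff_one_plus_X_power)
qed

text \<open>By Pascal's rule neighbouring entries of row p^n - 1 add up to an inner entry of row
  p^n, which is 0 in F; the entries therefore alternate, starting from 1.\<close>

lemma char_power_pred_binomial:
  assumes "prime p" "CHAR('f::field) = p" "i < p ^ n"
  shows "of_nat (p ^ n - 1 choose i) = ((- 1) ^ i :: 'f)"
  using assms(3)
proof (induction i)
  case (Suc i)
  have "p ^ n = Suc (p ^ n - 1)" using Suc.prems by simp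
  then have "p ^ n choose Suc i = (p ^ n - 1 choose i) + (p ^ n - 1 choose Suc i)"
    by (metis binomial_Suc_Suc)
  then have "of_nat (p ^ n - 1 choose i) + of_nat (p ^ n - 1 choose Suc i) = (0::'f)"
    using char_power_binomial[OF assms(1,2), of "Suc i" n] Suc.prems by (metis of_nat_add zero_less_Suc)
  with Suc show ?case by (simp add: add_eq_0_iff)
qed simp

lemma char_power_minus_1:
  assumes "prime p" "CHAR('f::field) = p"
  shows "(- 1) ^ (p ^ n) = (- 1 :: 'f)"
proof (cases "p = 2")
  case True
  then have "(of_nat 2 :: 'f) = 0" using assms(2) by (metis of_nat_CHAR)
  then have "(1::'f) + 1 = 0" by simp
  then have "(- 1 :: 'f) = 1" by (metis minus_unique)
  then show ?thesis by (metis power_one)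
next
  case False
  then have "odd p" using assms(1) prime_odd_nat prime_gt_1_nat[of p] by force
  then show ?thesis by simp
qed

text \<open>Pascal's rule against an arbitrary weight. Apart from the iteration below,
  \<open>ker_inter_image\<close> uses it to merge two neighbouring equations into one whose upper
  index is larger by 1.\<close>

lemma sum_binomial_Suc:
  fixes F :: "nat \<Rightarrow> 'f::comm_ring_1"
  shows "(\<Sum>k\<le>Suc m. of_nat (Suc m choose k) * F k) =
    (\<Sum>k\<le>m. of_nat (m choose k) * F (Suc k)) + (\<Sum>k\<le>m. of_nat (m choose k) * F k)"
proof -
  have "(\<Sum>k\<le>m. of_nat (m choose k) * F k) = (\<Sum>k\<le>Suc m. of_nat (m choose k) * F k)"
    by (simp add: binomial_eq_0)
  also have "\<dots> = F 0 + (\<Sum>k\<le>m. of_nat (m choose Suc k) * F (Suc k))"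
    by (subst sum.atMost_Suc_shift) simp
  finally show ?thesis
    by (subst sum.atMost_Suc_shift) (simp add: sum.distrib algebra_simps)
qed

text \<open>Binomial theorem for the sum of two commuting index shifts by \<open>e\<close>. The
  value e = 1 serves g - 1 itself and e = p^n its Frobenius power. The recurrence is asked for
  positive indices only, since index 0 is not a coordinate.\<close>

lemma binomial_shift_iterate:
  fixes c :: "nat \<Rightarrow> nat \<Rightarrow> nat \<Rightarrow> 'f::comm_ring_1"
  assumes step: "\<And>m i j. 1 \<le> i \<Longrightarrow> 1 \<le> j \<Longrightarrow> c (Suc m) i j = c m (i + e) j + c m i (j + e)"
    and "1 \<le> i" "1 \<le> j"
  shows "c m i j = (\<Sum>k\<le>m. of_nat (m choose k) * c 0 (i + k * e) (j + (m - k) * e))"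
  using assms(2,3)
proof (induction m arbitrary: i j)
  case (Suc m)
  have "c (Suc m) i j = (\<Sum>k\<le>m. of_nat (m choose k) * c 0 (i + e + k * e) (j + (m - k) * e)) +
      (\<Sum>k\<le>m. of_nat (m choose k) * c 0 (i + k * e) (j + e + (m - k) * e))"
    using Suc by (simp add: step)
  also have "(\<Sum>k\<le>m. of_nat (m choose k) * c 0 (i + e + k * e) (j + (m - k) * e)) =
      (\<Sum>k\<le>m. of_nat (m choose k) * c 0 (i + Suc k * e) (j + (Suc m - Suc k) * e))"
    by (simp add: algebra_simps)
  also have "(\<Sum>k\<le>m. of_nat (m choose k) * c 0 (i + k * e) (j + e + (m - k) * e)) =
      (\<Sum>k\<le>m. of_nat (m choose k) * c 0 (i + k * e) (j + (Suc m - k) * e))"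
  proof (intro sum.cong refl)
    fix k assume "k \<in> {..m}"
    then have "j + e + (m - k) * e = j + (Suc m - k) * e" by (simp add: Suc_diff_le)
    then show "of_nat (m choose k) * c 0 (i + k * e) (j + e + (m - k) * e) =
        of_nat (m choose k) * c 0 (i + k * e) (j + (Suc m - k) * e)" by (simp only:)
  qed
  finally show ?case
    by (simp only: sum_binomial_Suc[of m "\<lambda>k. c 0 (i + k * e) (j + (Suc m - k) * e)"])
qed simp

text \<open>The summation range is exchanged for the window that supports \<open>h\<close>. Indices
  outside the old range cost nothing because \<open>binom_F\<close> is 0 there. This brings a
  binomial sum into the form of a row of a Toeplitz matrix such as \<open>P_mat\<close>.\<close>

lemma binomial_sum_support:
  fixes h :: "nat \<Rightarrow> 'f::field"
  assumes "\<And>i. i \<notin> {lo..<lo + b} \<Longrightarrow> h i = 0"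
  shows "(\<Sum>k\<le>c. of_nat (c choose k) * h (m + k)) =
    (\<Sum>j<b. binom_F c (int lo + int j - int m) * h (lo + j))"
proof -
  have "(\<Sum>k\<le>c. of_nat (c choose k) * h (m + k)) = (\<Sum>i\<in>(+) m ` {..c}. binom_F c (int i - int m) * h i)"
    by (subst sum.reindex) (auto simp: binom_F_def)
  also have "\<dots> = (\<Sum>i\<in>(+) m ` {..c} \<union> {lo..<lo + b}. binom_F c (int i - int m) * h i)"
  proof (rule sum.mono_neutral_left)
    show "\<forall>i\<in>((+) m ` {..c} \<union> {lo..<lo + b}) - (+) m ` {..c}. binom_F c (int i - int m) * h i = 0"
    proof
      fix i assume i: "i \<in> ((+) m ` {..c} \<union> {lo..<lo + b}) - (+) m ` {..c}"
      have "i < m \<or> i > m + c"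
      proof (rule ccontr)
        assume "\<not> ?thesis"
        then have "i = m + (i - m)" "i - m \<le> c" by auto
        then have "i \<in> (+) m ` {..c}" by blast
        with i show False by blast
      qed
      then show "binom_F c (int i - int m) * h i = 0"
        by (auto simp: binom_F_def binomial_eq_0)
    qed
  qed auto
  also have "\<dots> = (\<Sum>i\<in>(+) lo ` {..<b}. binom_F c (int i - int m) * h i)"
  proof (rule sum.mono_neutral_right)
    have eq: "(+) lo ` {..<b} = {lo..<lo + b}"
      by (simp add: lessThan_atLeast0 image_add_atLeastLessThan add.commute)
    show "\<forall>i\<in>(+) m ` {..c} \<union> {lo..<lo + b} - (+) lo ` {..<b}. binom_F c (int i - int m) * h i = 0"
      unfolding eq using assms by auto
    show "(+) lo ` {..<b} \<subseteq> (+) m ` {..c} \<union> {lo..<lo + b}" unfolding eq by blast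
  qed auto
  also have "\<dots> = (\<Sum>j<b. binom_F c (int lo + int j - int m) * h (lo + j))"
    by (subst sum.reindex) auto
  finally show ?thesis .
qed

lemma mult_add_unique:
  fixes P :: nat
  assumes "m * P + x = m' * P + y" "x < P" "y < P"
  shows "m = m' \<and> x = y"
proof -
  have "(m * P + x) div P = m" "(m' * P + y) div P = m'" using assms(2,3) by auto
  with assms show ?thesis by auto
qed

section \<open>Maps that are linear on a subspace\<close>

lemma vector_space_field: "vector_space ((*) :: 'f::field \<Rightarrow> 'f \<Rightarrow> 'f)"
  by unfold_locales (auto simp: algebra_simps)

lemma linear_on_space_0:
  assumes "vector_space sc" "module.subspace sc V" "linear_on_space sc V sc' f"
  shows "f 0 = 0"
proof -
  interpret vector_space sc by fact
  have "f (0 + 0) = f 0 + f 0"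
    using assms(3) subspace_0[OF assms(2)] unfolding linear_on_space_def by blast
  then show ?thesis by simp
qed

lemma linear_on_space_sum:
  assumes "vector_space sc" "module.subspace sc V" "linear_on_space sc V sc' f"
    and "\<And>a. a \<in> A \<Longrightarrow> x a \<in> V"
  shows "f (\<Sum>a\<in>A. x a) = (\<Sum>a\<in>A. f (x a))"
  using assms(4)
proof (induction A rule: infinite_finite_induct)
  case (insert a A)
  interpret vector_space sc by fact
  have "(\<Sum>a\<in>A. x a) \<in> V" using insert.prems by (intro subspace_sum[OF assms(2)]) auto
  then have "f (x a + (\<Sum>a\<in>A. x a)) = f (x a) + f (\<Sum>a\<in>A. x a)"
    using assms(3) insert.prems unfolding linear_on_space_def by blast
  with insert show ?case by simp
qed (use linear_on_space_0[OF assms(1-3)] in auto)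

lemma linear_on_space_diff:
  assumes "vector_space sc" "vector_space sc'" "module.subspace sc V" "linear_on_space sc V sc' f" "x \<in> V" "y \<in> V"
  shows "f (x - y) = f x - f y"
proof -
  interpret vector_space sc by fact
  interpret w: vector_space sc' by fact
  have "f (x + sc (-1) y) = f x + sc' (-1) (f y)"
    using assms(4-6) subspace_scale[OF assms(3)] unfolding linear_on_space_def by metis
  then show ?thesis by simp
qed

lemma linear_on_space_subset:
  "linear_on_space sc V sc' f \<Longrightarrow> W \<subseteq> V \<Longrightarrow> linear_on_space sc W sc' f"
  unfolding linear_on_space_def by blast

section \<open>The module V_q in coordinates\<close>

locale Vq_module =
  fixes G :: "('g, 'c) monoid_scheme" and g :: 'g and q :: nat
    and sc :: "'f::field \<Rightarrow> 'v::ab_group_add \<Rightarrow> 'v"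
    and act :: "'g \<Rightarrow> 'v \<Rightarrow> 'v" and v :: "nat \<Rightarrow> 'v"
  assumes grp: "group G" and g: "g \<in> carrier G" and card_G: "card (carrier G) = q" and q_pos: "q > 0"
    and Vq: "is_Vq G g q sc act v"
begin

lemma FG: "FG_module G sc (V_sub sc v q) act"
  using Vq unfolding is_Vq_def by blast

sublocale vs: vector_space sc
  using FG unfolding FG_module_def by blast

sublocale grp: group G by (rule grp)

lemma V_sub_subspace: "vs.subspace (V_sub sc v m)"
  unfolding V_sub_def by (rule vs.subspace_span)

lemma V_sub_mono: "m \<le> m' \<Longrightarrow> V_sub sc v m \<subseteq> V_sub sc v m'"
  unfolding V_sub_def by (intro vs.span_mono image_mono) auto

lemma v_in_V_sub: "1 \<le> i \<Longrightarrow> i \<le> m \<Longrightarrow> v i \<in> V_sub sc v m"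
  unfolding V_sub_def by (intro vs.span_base) auto

lemma act_closed: "h \<in> carrier G \<Longrightarrow> x \<in> V_sub sc v q \<Longrightarrow> act h x \<in> V_sub sc v q"
  using FG unfolding FG_module_def by blast

lemma act_linear: "h \<in> carrier G \<Longrightarrow> linear_on_space sc (V_sub sc v q) sc (act h)"
  using FG unfolding FG_module_def by blast

lemma act_one: "x \<in> V_sub sc v q \<Longrightarrow> act \<one>\<^bsub>G\<^esub> x = x"
  using FG unfolding FG_module_def by blast

lemma act_mult: "h \<in> carrier G \<Longrightarrow> k \<in> carrier G \<Longrightarrow> x \<in> V_sub sc v q \<Longrightarrow>
    act (h \<otimes>\<^bsub>G\<^esub> k) x = act h (act k x)"
  using FG unfolding FG_module_def by blast

lemma v_indep: "vs.independent (v ` {1..q})" and v_inj: "inj_on v {1..q}"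
  using Vq unfolding is_Vq_def by blast+

text \<open>The value 0 outside {1..q} lets the shift rule \<open>coord_act_g\<close> hold at i = q
  and beyond without a case distinction.\<close>

definition coord :: "nat \<Rightarrow> 'v \<Rightarrow> 'f" where
  "coord i x = (if i \<in> {1..q} then vs.representation (v ` {1..q}) x (v i) else 0)"

lemma coord_linear: "linear_on_space sc (V_sub sc v q) (*) (coord i)"
  unfolding linear_on_space_def V_sub_def coord_def
  by (auto simp: vs.representation_add[OF v_indep] vs.representation_scale[OF v_indep] simp del: One_nat_def)

lemma coord_add: "x \<in> V_sub sc v q \<Longrightarrow> y \<in> V_sub sc v q \<Longrightarrow> coord i (x + y) = coord i x + coord i y"
  and coord_scale: "x \<in> V_sub sc v q \<Longrightarrow> coord i (sc c x) = c * coord i x"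
  using coord_linear[of i] unfolding linear_on_space_def by blast+

lemma coord_0: "coord i 0 = 0"
  by (rule linear_on_space_0[OF vs.vector_space_axioms V_sub_subspace coord_linear])

lemma coord_diff: "x \<in> V_sub sc v q \<Longrightarrow> y \<in> V_sub sc v q \<Longrightarrow> coord i (x - y) = coord i x - coord i y"
  by (rule linear_on_space_diff[OF vs.vector_space_axioms vector_space_field V_sub_subspace coord_linear])

lemma coord_v:
  assumes j: "1 \<le> j" "j \<le> q"
  shows "coord i (v j) = (if i = j then 1 else 0)"
proof -
  have "vs.representation (v ` {1..q}) (v j) b = (if b = v j then 1 else 0)" for b
    using vs.representation_basis[OF v_indep, of "v j"] j by (simp del: One_nat_def)
  moreover have "v i = v j \<longleftrightarrow> i = j" if "i \<in> {1..q}"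
    using inj_onD[OF v_inj, of i j] that j by auto
  ultimately show ?thesis using j by (simp add: coord_def)
qed

lemma coord_expand:
  assumes "x \<in> V_sub sc v q"
  shows "x = (\<Sum>i=1..q. sc (coord i x) (v i))"
proof -
  have "x = (\<Sum>b\<in>v ` {1..q}. sc (vs.representation (v ` {1..q}) x b) b)"
    using assms unfolding V_sub_def
    by (intro vs.sum_representation_eq[symmetric] v_indep) auto
  also have "\<dots> = (\<Sum>i=1..q. sc (coord i x) (v i))"
    by (subst sum.reindex[OF v_inj]) (simp add: coord_def)
  finally show ?thesis .
qed

lemma mem_V_sub_iff:
  assumes "m \<le> q"
  shows "x \<in> V_sub sc v m \<longleftrightarrow> x \<in> V_sub sc v q \<and> (\<forall>i>m. coord i x = 0)"
proof
  assume "x \<in> V_sub sc v m"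
  then show "x \<in> V_sub sc v q \<and> (\<forall>i>m. coord i x = 0)"
    unfolding V_sub_def[of _ _ m]
  proof (rule vs.span_induct)
    show "vs.subspace {x. x \<in> V_sub sc v q \<and> (\<forall>i>m. coord i x = 0)}"
      using V_sub_subspace[of q]
      by (auto simp: vs.subspace_def coord_add coord_scale coord_0)
    show "x \<in> V_sub sc v q \<and> (\<forall>i>m. coord i x = 0)" if "x \<in> v ` {1..m}" for x
      using that assms by (auto simp: coord_v v_in_V_sub)
  qed
next
  assume x: "x \<in> V_sub sc v q \<and> (\<forall>i>m. coord i x = 0)"
  have "(\<Sum>i=1..q. sc (coord i x) (v i)) = (\<Sum>i=1..m. sc (coord i x) (v i))"
    using assms x by (intro sum.mono_neutral_right) auto
  also have "\<dots> \<in> V_sub sc v m"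
    by (intro vs.subspace_sum[OF V_sub_subspace] vs.subspace_scale[OF V_sub_subspace] v_in_V_sub) auto
  finally show "x \<in> V_sub sc v m" using coord_expand[of x] x by simp
qed

lemma coord_expand_V_sub:
  assumes "x \<in> V_sub sc v m" "m \<le> q"
  shows "x = (\<Sum>i=1..m. sc (coord i x) (v i))"
proof -
  have x: "x \<in> V_sub sc v q \<and> (\<forall>i>m. coord i x = 0)" using mem_V_sub_iff assms by blast
  have "(\<Sum>i=1..q. sc (coord i x) (v i)) = (\<Sum>i=1..m. sc (coord i x) (v i))"
    using assms x by (intro sum.mono_neutral_right) auto
  with coord_expand[of x] x show ?thesis by simp
qed

lemma coord_eq_0:
  assumes "x \<in> V_sub sc v q" "\<And>i. 1 \<le> i \<Longrightarrow> i \<le> q \<Longrightarrow> coord i x = 0"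
  shows "x = 0"
  using coord_expand[OF assms(1)] assms(2) by simp

lemma act_g_v: "1 \<le> i \<Longrightarrow> i \<le> q \<Longrightarrow> act g (v i) = (if i = 1 then v 1 else v (i - 1) + v i)"
  using Vq unfolding is_Vq_def by auto

text \<open>Since v_(i+1) contributes v_i, coordinate i of the image also picks up coordinate i + 1.
  Index 0 is excluded: \<open>coord 0\<close> is 0 by convention, but \<open>coord 1\<close> need
  not be. Membership in V_q is carried through the span induction because \<open>act g\<close> is
  linear only there.\<close>

lemma coord_act_g:
  assumes "x \<in> V_sub sc v q" "1 \<le> i"
  shows "coord i (act g x) = coord i x + coord (i + 1) x"
proof -
  have lin: "act g (x + y) = act g x + act g y" "act g (sc c x) = sc c (act g x)"
    if "x \<in> V_sub sc v q" "y \<in> V_sub sc v q" for x y c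
    using act_linear[OF g] that unfolding linear_on_space_def by blast+
  have act0: "act g 0 = 0"
    by (rule linear_on_space_0[OF vs.vector_space_axioms V_sub_subspace act_linear[OF g]])
  have "x \<in> V_sub sc v q \<and> coord i (act g x) = coord i x + coord (i + 1) x"
    using assms(1) unfolding V_sub_def[of _ _ q]
  proof (rule vs.span_induct)
    show "vs.subspace {x. x \<in> vs.span (v ` {1..q}) \<and> coord i (act g x) = coord i x + coord (i + 1) x}"
      using V_sub_subspace[of q] unfolding V_sub_def[symmetric]
      by (auto simp: vs.subspace_def coord_add coord_scale coord_0 lin act0 act_closed[OF g] algebra_simps)
    show "x \<in> vs.span (v ` {1..q}) \<and> coord i (act g x) = coord i x + coord (i + 1) x" if "x \<in> v ` {1..q}" for x
    proof -
      from that obtain j where j: "1 \<le> j" "j \<le> q" "x = v j" by auto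
      have "v (j - 1) \<in> V_sub sc v q" "v j \<in> V_sub sc v q" if "j \<noteq> 1"
        using that j by (auto intro!: v_in_V_sub)
      then have "coord i (act g x) = coord i x + coord (i + 1) x"
        using j assms(2) by (auto simp: act_g_v coord_v coord_add)
      with that show ?thesis by (auto intro: vs.span_base)
    qed
  qed
  then show ?thesis by blast
qed

lemma act_g_V_sub:
  assumes "m \<le> q" "x \<in> V_sub sc v m"
  shows "act g x \<in> V_sub sc v m"
proof -
  have x: "x \<in> V_sub sc v q" "\<forall>i>m. coord i x = 0" using mem_V_sub_iff[OF assms(1)] assms(2) by blast+
  then have "\<forall>i>m. coord i (act g x) = 0" using coord_act_g[of x] by simp
  then show ?thesis using mem_V_sub_iff[OF assms(1)] act_closed[OF g x(1)] by blast
qed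

lemma act_nat_pow_V_sub:
  fixes k :: nat
  assumes "m \<le> q" "x \<in> V_sub sc v m"
  shows "act (g [^]\<^bsub>G\<^esub> k) x \<in> V_sub sc v m"
  using assms(2)
proof (induction k arbitrary: x)
  case 0
  then show ?case using act_one V_sub_mono[OF assms(1)] by (auto simp: subset_iff)
next
  case (Suc k)
  have "x \<in> V_sub sc v q" using Suc.prems V_sub_mono[OF assms(1)] by auto
  then have "act (g [^]\<^bsub>G\<^esub> Suc k) x = act (g [^]\<^bsub>G\<^esub> k) (act g x)"
    using g by (simp add: act_mult)
  with Suc.IH act_g_V_sub[OF assms(1) Suc.prems] show ?case by simp
qed

lemma act_int_pow_V_sub:
  fixes z :: int
  assumes "m \<le> q" "x \<in> V_sub sc v m"
  shows "act (g [^]\<^bsub>G\<^esub> z) x \<in> V_sub sc v m"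
proof (cases "z < 0")
  case False
  then have "g [^]\<^bsub>G\<^esub> z = g [^]\<^bsub>G\<^esub> nat z" by (simp only: int_pow_def2 if_False)
  then show ?thesis using act_nat_pow_V_sub[OF assms, of "nat z"] by (simp only:)
next
  case True
  define k where "k = nat (- z)"
  \<comment> \<open>The group has order q, so g^q = 1 and the inverse of g^k is g^(k(q-1)). Negative
    powers thus reduce to natural ones.\<close>
  have "k * (q - 1) + k = q * k" using q_pos by (cases q) auto
  then have "g [^]\<^bsub>G\<^esub> (k * (q - 1)) \<otimes>\<^bsub>G\<^esub> g [^]\<^bsub>G\<^esub> k = (g [^]\<^bsub>G\<^esub> q) [^]\<^bsub>G\<^esub> k"
    using g by (simp add: grp.nat_pow_mult grp.nat_pow_pow)
  also have "g [^]\<^bsub>G\<^esub> q = \<one>\<^bsub>G\<^esub>"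
    using grp.pow_order_eq_1[OF g] card_G by (simp add: Coset.order_def)
  finally have "g [^]\<^bsub>G\<^esub> (k * (q - 1)) \<otimes>\<^bsub>G\<^esub> g [^]\<^bsub>G\<^esub> k = \<one>\<^bsub>G\<^esub>"
    by (simp only: grp.nat_pow_one)
  then have "inv\<^bsub>G\<^esub> (g [^]\<^bsub>G\<^esub> k) = g [^]\<^bsub>G\<^esub> (k * (q - 1))"
    by (rule grp.inv_equality) (rule grp.nat_pow_closed[OF g])+
  then have "g [^]\<^bsub>G\<^esub> z = g [^]\<^bsub>G\<^esub> (k * (q - 1))"
    unfolding int_pow_def2 k_def[symmetric] using True by (simp only: if_True)
  then show ?thesis using act_nat_pow_V_sub[OF assms, of "k * (q - 1)"] by (simp only:)
qed

lemma act_g_minus_1_V_sub: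
  assumes "m \<le> q" "x \<in> V_sub sc v m"
  shows "act g x - x \<in> V_sub sc v m"
  using act_g_V_sub[OF assms] assms(2) by (intro vs.subspace_diff[OF V_sub_subspace])

lemma coord_g_minus_1_pow:
  assumes "x \<in> V_sub sc v q" "1 \<le> i"
  shows "coord i (g_minus_1_pow act g k x) = coord (i + k) x"
  using assms
proof (induction k arbitrary: x)
  case 0
  then show ?case by (simp add: g_minus_1_pow_def)
next
  case (Suc k)
  have "g_minus_1_pow act g (Suc k) x = g_minus_1_pow act g k (act g x - x)"
    by (simp add: g_minus_1_pow_def funpow_Suc_right del: funpow.simps)
  also have "coord i \<dots> = coord (i + k) (act g x - x)"
    using Suc act_g_minus_1_V_sub[of q x] by simp
  also have "\<dots> = coord (i + k) (act g x) - coord (i + k) x"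
    using Suc.prems act_closed[OF g] by (intro coord_diff)
  also have "\<dots> = coord (i + Suc k) x"
    using Suc.prems coord_act_g[of x "i + k"] by simp
  finally show ?case .
qed

end

section \<open>Coordinates on the tensor product of V_r and V_s\<close>

locale tensor_module = Vq_module G g q sc act v
  for G :: "('g, 'c) monoid_scheme" and g :: 'g and q :: nat
    and sc :: "'f::field \<Rightarrow> 'v::ab_group_add \<Rightarrow> 'v"
    and act :: "'g \<Rightarrow> 'v \<Rightarrow> 'v" and v :: "nat \<Rightarrow> 'v" +
  fixes r s n :: nat and scT :: "'f \<Rightarrow> 't::ab_group_add \<Rightarrow> 't"
    and actT :: "'g \<Rightarrow> 't \<Rightarrow> 't" and T :: "'t set" and tens :: "'v \<Rightarrow> 'v \<Rightarrow> 't"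
  assumes r_le: "r \<le> q" and s_le: "s \<le> q"
    and tensor: "is_tensor_module G sc act (V_sub sc v r) (V_sub sc v s) scT actT T tens"
begin

abbreviation Vr where "Vr \<equiv> V_sub sc v r"
abbreviation Vs where "Vs \<equiv> V_sub sc v s"
abbreviation w where "w \<equiv> v_tensor G g n act v tens"

lemma tp: "is_tensor_product sc Vr sc Vs scT T tens"
  using tensor unfolding is_tensor_module_def by blast

sublocale vt: vector_space scT
  using tp unfolding is_tensor_product_def by blast

lemma T_subspace: "vt.subspace T"
  using tp unfolding is_tensor_product_def by blast

lemma tens_closed: "x \<in> Vr \<Longrightarrow> y \<in> Vs \<Longrightarrow> tens x y \<in> T"
  using tp unfolding is_tensor_product_def by blast

lemma tens_bilinear: "bilinear_on_spaces sc Vr sc Vs scT tens"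
  using tp unfolding is_tensor_product_def by blast

lemma tensor_universal:
  assumes "bilinear_on_spaces sc Vr sc Vs (*) B"
  obtains L where "linear_on_space scT T (*) L" "\<And>x y. x \<in> Vr \<Longrightarrow> y \<in> Vs \<Longrightarrow> L (tens x y) = B x y"
    "\<And>L' u. linear_on_space scT T (*) L' \<Longrightarrow> (\<And>x y. x \<in> Vr \<Longrightarrow> y \<in> Vs \<Longrightarrow> L' (tens x y) = B x y)
        \<Longrightarrow> u \<in> T \<Longrightarrow> L' u = L u"
proof -
  have "\<exists>L. linear_on_space scT T (*) L \<and> (\<forall>x\<in>Vr. \<forall>y\<in>Vs. L (tens x y) = B x y) \<and>
         (\<forall>L'. linear_on_space scT T (*) L' \<and> (\<forall>x\<in>Vr. \<forall>y\<in>Vs. L' (tens x y) = B x y)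
            \<longrightarrow> (\<forall>u\<in>T. L' u = L u))"
    using tp assms unfolding is_tensor_product_def by blast
  then obtain L where L: "linear_on_space scT T (*) L" "\<forall>x\<in>Vr. \<forall>y\<in>Vs. L (tens x y) = B x y"
    "\<forall>L'. linear_on_space scT T (*) L' \<and> (\<forall>x\<in>Vr. \<forall>y\<in>Vs. L' (tens x y) = B x y) \<longrightarrow> (\<forall>u\<in>T. L' u = L u)"
    by blast
  show ?thesis
    by (rule that[of L]) (use L in blast)+
qed

text \<open>The uniqueness half of the universal property, applied to the bilinear form that
  \<open>L'\<close> induces. It allows checking on pure tensors before these are known to span
  \<open>T\<close>.\<close>

lemma linear_forms_agree:
  assumes "linear_on_space scT T (*) L" "linear_on_space scT T (*) L'"
    and "\<And>x y. x \<in> Vr \<Longrightarrow> y \<in> Vs \<Longrightarrow> L (tens x y) = L' (tens x y)" "u \<in> T"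
  shows "L u = L' u"
proof -
  have "bilinear_on_spaces sc Vr sc Vs (*) (\<lambda>x y. L' (tens x y))"
    using tens_bilinear assms(2) tens_closed
    unfolding bilinear_on_spaces_def linear_on_space_def by auto
  then obtain L0 where L0: "\<And>L u. linear_on_space scT T (*) L \<Longrightarrow>
    (\<And>x y. x \<in> Vr \<Longrightarrow> y \<in> Vs \<Longrightarrow> L (tens x y) = L' (tens x y)) \<Longrightarrow> u \<in> T \<Longrightarrow> L u = L0 u"
    by (rule tensor_universal) blast
  have "L u = L0 u" using L0[OF assms(1,3,4)] by blast
  moreover have "L' u = L0 u" using L0[OF assms(2) refl assms(4)] by blast
  ultimately show ?thesis by simp
qed

definition N :: "'t \<Rightarrow> 't" where "N u = actT g u - u"

lemma g_minus_1_pow_N: "g_minus_1_pow actT g m = N ^^ m"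
proof -
  have "N = (\<lambda>u. actT g u - u)" by (rule ext) (rule N_def)
  then show ?thesis by (simp add: g_minus_1_pow_def)
qed

lemma actT_g: "x \<in> Vr \<Longrightarrow> y \<in> Vs \<Longrightarrow> actT g (tens x y) = tens (act g x) (act g y)"
  using tensor g unfolding is_tensor_module_def by blast

lemma actT_g_closed: "u \<in> T \<Longrightarrow> actT g u \<in> T"
  and actT_g_linear: "linear_on_space scT T scT (actT g)"
  using tensor g unfolding is_tensor_module_def FG_module_def by blast+

lemma N_closed: "u \<in> T \<Longrightarrow> N u \<in> T"
  unfolding N_def using actT_g_closed by (intro vt.subspace_diff[OF T_subspace])

lemma N_pow_closed: "u \<in> T \<Longrightarrow> (N ^^ m) u \<in> T"
  by (induction m) (auto intro: N_closed)

lemma N_linear: "linear_on_space scT T scT N"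
  using actT_g_linear unfolding linear_on_space_def N_def
  by (auto simp: algebra_simps vt.scale_right_diff_distrib)

text \<open>The bilinear form behind the coordinate of \<open>w i j\<close>: the power g^(i-n)
  undoes the twist g^(n-i) in \<open>v_tensor\<close> before coordinate j is read off.\<close>

definition tform :: "nat \<Rightarrow> nat \<Rightarrow> 'v \<Rightarrow> 'v \<Rightarrow> 'f" where
  "tform i j x y = (if i = 0 \<or> j = 0 then 0 else coord i x * coord j (act (g [^]\<^bsub>G\<^esub> (int i - int n)) y))"

lemma Vr_Vq: "x \<in> Vr \<Longrightarrow> x \<in> V_sub sc v q" and Vs_Vq: "x \<in> Vs \<Longrightarrow> x \<in> V_sub sc v q"
  using V_sub_mono[OF r_le] V_sub_mono[OF s_le] by auto

lemma g_pow_carrier: "g [^]\<^bsub>G\<^esub> (z::int) \<in> carrier G"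
  using g by simp

lemma act_g_pow_linear: "linear_on_space sc Vs sc (act (g [^]\<^bsub>G\<^esub> (z::int)))"
  using act_linear[OF g_pow_carrier] V_sub_mono[OF s_le] by (rule linear_on_space_subset)

lemma tform_bilinear: "bilinear_on_spaces sc Vr sc Vs (*) (tform i j)"
proof -
  have act: "act (g [^]\<^bsub>G\<^esub> z) (y + y') = act (g [^]\<^bsub>G\<^esub> z) y + act (g [^]\<^bsub>G\<^esub> z) y'"
    "act (g [^]\<^bsub>G\<^esub> z) (sc c y) = sc c (act (g [^]\<^bsub>G\<^esub> z) y)"
    "act (g [^]\<^bsub>G\<^esub> z) y \<in> V_sub sc v q"
    if "y \<in> Vs" "y' \<in> Vs" for y y' c and z :: int
    using act_g_pow_linear that act_closed[OF g_pow_carrier Vs_Vq]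
    unfolding linear_on_space_def by blast+
  show ?thesis
    unfolding bilinear_on_spaces_def linear_on_space_def tform_def
    by (auto simp: act coord_add coord_scale Vr_Vq algebra_simps)
qed

text \<open>The universal property supplies a linear form for each index pair. The choice does not
  depend on \<open>u\<close>, so linearity in \<open>u\<close> is inherited from the chosen
  form.\<close>

definition Phi :: "'t \<Rightarrow> nat \<Rightarrow> nat \<Rightarrow> 'f" where
  "Phi u i j = (SOME L. linear_on_space scT T (*) L \<and>
      (\<forall>x\<in>Vr. \<forall>y\<in>Vs. L (tens x y) = tform i j x y)) u"

lemma Phi_linear: "linear_on_space scT T (*) (\<lambda>u. Phi u i j)"
  and Phi_tens: "x \<in> Vr \<Longrightarrow> y \<in> Vs \<Longrightarrow> Phi (tens x y) i j = tform i j x y"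
proof -
  let ?P = "\<lambda>L. linear_on_space scT T (*) L \<and> (\<forall>x\<in>Vr. \<forall>y\<in>Vs. L (tens x y) = tform i j x y)"
  have "\<exists>L. ?P L" by (rule tensor_universal[OF tform_bilinear[of i j]]) blast
  then have "?P (Eps ?P)" by (rule someI_ex)
  moreover have "Eps ?P = (\<lambda>u. Phi u i j)" by (simp add: Phi_def)
  ultimately have "?P (\<lambda>u. Phi u i j)" by simp
  then show "linear_on_space scT T (*) (\<lambda>u. Phi u i j)"
    "x \<in> Vr \<Longrightarrow> y \<in> Vs \<Longrightarrow> Phi (tens x y) i j = tform i j x y" by blast+
qed

lemma Phi_add: "u \<in> T \<Longrightarrow> u' \<in> T \<Longrightarrow> Phi (u + u') i j = Phi u i j + Phi u' i j"
  and Phi_scale: "u \<in> T \<Longrightarrow> Phi (scT c u) i j = c * Phi u i j"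
  using Phi_linear[of i j] unfolding linear_on_space_def by blast+

lemma Phi_zero: "Phi 0 i j = 0"
  by (rule linear_on_space_0[OF vt.vector_space_axioms T_subspace Phi_linear])

lemma Phi_sum: "(\<And>a. a \<in> A \<Longrightarrow> x a \<in> T) \<Longrightarrow> Phi (\<Sum>a\<in>A. x a) i j = (\<Sum>a\<in>A. Phi (x a) i j)"
  by (rule linear_on_space_sum[OF vt.vector_space_axioms T_subspace Phi_linear])

lemma Phi_diff: "u \<in> T \<Longrightarrow> u' \<in> T \<Longrightarrow> Phi (u - u') i j = Phi u i j - Phi u' i j"
  by (rule linear_on_space_diff[OF vt.vector_space_axioms vector_space_field T_subspace Phi_linear])

lemma tform_outside:
  assumes "x \<in> Vr" "y \<in> Vs" "\<not> (1 \<le> i \<and> i \<le> r \<and> 1 \<le> j \<and> j \<le> s)"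
  shows "tform i j x y = 0"
  using assms act_int_pow_V_sub[OF s_le assms(2), of "int i - int n"]
    mem_V_sub_iff[OF r_le] mem_V_sub_iff[OF s_le]
  unfolding tform_def by (auto simp: not_le)

text \<open>V_r and V_s are stable under all powers of g, so the twist in \<open>tform\<close>
  cannot create coordinates beyond r and s.\<close>

lemma Phi_outside:
  assumes "u \<in> T" "\<not> (1 \<le> i \<and> i \<le> r \<and> 1 \<le> j \<and> j \<le> s)"
  shows "Phi u i j = 0"
  using Phi_linear _ _ assms(1)
proof (rule linear_forms_agree)
  show "linear_on_space scT T (*) (\<lambda>u. 0 :: 'f)" by (simp add: linear_on_space_def)
  show "Phi (tens x y) i j = 0" if "x \<in> Vr" "y \<in> Vs" for x y
    using that by (simp add: Phi_tens tform_outside[OF that assms(2)])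
qed

text \<open>This identity is the purpose of the twist g^(n-i). With a the coordinates of x and b
  those of y' = g^(i-n) y, the left side on a pure tensor is (a_i + a_(i+1))(b_j + b_(j+1)) - a_i
  b_j. The cross term a_(i+1) b_(j+1) is absorbed because row i + 1 reads its coordinate from g y',
  where coordinate j is b_j + b_(j+1).\<close>

lemma Phi_N:
  assumes "u \<in> T" "1 \<le> i" "1 \<le> j"
  shows "Phi (N u) i j = Phi u (i + 1) j + Phi u i (j + 1)"
  using _ _ _ assms(1)
proof (rule linear_forms_agree)
  show "linear_on_space scT T (*) (\<lambda>u. Phi (N u) i j)"
    using N_linear N_closed unfolding linear_on_space_def by (auto simp: Phi_add Phi_scale)
  show "linear_on_space scT T (*) (\<lambda>u. Phi u (i + 1) j + Phi u i (j + 1))"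
    unfolding linear_on_space_def by (auto simp: Phi_add Phi_scale algebra_simps)
  fix x y assume x: "x \<in> Vr" and y: "y \<in> Vs"
  define y' where "y' = act (g [^]\<^bsub>G\<^esub> (int i - int n)) y"
  have y': "y' \<in> V_sub sc v q"
    unfolding y'_def by (intro act_closed g_pow_carrier Vs_Vq y)
  have c1: "g [^]\<^bsub>G\<^esub> (int i - int n) \<otimes>\<^bsub>G\<^esub> g = g [^]\<^bsub>G\<^esub> (int (i + 1) - int n)"
    using grp.int_pow_mult[OF g, of "int i - int n" 1] g by (simp add: algebra_simps)
  have c2: "g \<otimes>\<^bsub>G\<^esub> g [^]\<^bsub>G\<^esub> (int i - int n) = g [^]\<^bsub>G\<^esub> (int (i + 1) - int n)"
    using grp.int_pow_mult[OF g, of 1 "int i - int n"] g by (simp add: algebra_simps)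
  have s1: "act (g [^]\<^bsub>G\<^esub> (int i - int n)) (act g y) = act g y'"
    unfolding y'_def using act_mult[OF g_pow_carrier g Vs_Vq[OF y]] act_mult[OF g g_pow_carrier Vs_Vq[OF y]] c1 c2
    by metis
  have s2: "act (g [^]\<^bsub>G\<^esub> (int (i + 1) - int n)) y = act g y'"
    unfolding y'_def using act_mult[OF g g_pow_carrier Vs_Vq[OF y]] c2 by metis
  have gx: "act g x \<in> Vr" and gy: "act g y \<in> Vs"
    using act_g_V_sub r_le s_le x y by blast+
  have "Phi (N (tens x y)) i j = tform i j (act g x) (act g y) - tform i j x y"
    using x y gx gy by (simp add: N_def actT_g Phi_diff tens_closed Phi_tens)
  also have "\<dots> = tform (i + 1) j x y + tform i (j + 1) x y"
    using assms(2,3) x y y' coord_act_g[OF Vr_Vq[OF x] assms(2)] coord_act_g[OF y' assms(3)]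
    unfolding tform_def s1 s2 by (simp add: y'_def[symmetric] algebra_simps)
  finally show "Phi (N (tens x y)) i j = Phi (tens x y) (i + 1) j + Phi (tens x y) i (j + 1)"
    using x y by (simp add: Phi_tens)
qed

lemma w_in_T: "i \<le> r \<Longrightarrow> j \<le> s \<Longrightarrow> w i j \<in> T"
  unfolding v_tensor_def using vt.subspace_0[OF T_subspace]
  by (auto intro!: tens_closed v_in_V_sub act_int_pow_V_sub s_le)

lemma g_pow_cancel:
  assumes "y \<in> Vs"
  shows "act (g [^]\<^bsub>G\<^esub> (int i - int n)) (act (g [^]\<^bsub>G\<^esub> (int n - int i)) y) = y"
    and "act (g [^]\<^bsub>G\<^esub> (int n - int i)) (act (g [^]\<^bsub>G\<^esub> (int i - int n)) y) = y"
proof -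
  have "act (g [^]\<^bsub>G\<^esub> z) (act (g [^]\<^bsub>G\<^esub> z') y) = y" if "z + z' = 0" for z z' :: int
  proof -
    have "g [^]\<^bsub>G\<^esub> z \<otimes>\<^bsub>G\<^esub> g [^]\<^bsub>G\<^esub> z' = \<one>\<^bsub>G\<^esub>"
      using grp.int_pow_mult[OF g, of z z'] that by simp
    then show ?thesis
      using act_mult[OF g_pow_carrier g_pow_carrier Vs_Vq[OF assms], of z z'] act_one[OF Vs_Vq[OF assms]] by simp
  qed
  from this[of "int i - int n" "int n - int i"] this[of "int n - int i" "int i - int n"]
  show "act (g [^]\<^bsub>G\<^esub> (int i - int n)) (act (g [^]\<^bsub>G\<^esub> (int n - int i)) y) = y"
    and "act (g [^]\<^bsub>G\<^esub> (int n - int i)) (act (g [^]\<^bsub>G\<^esub> (int i - int n)) y) = y" by simp_all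
qed

lemma Phi_w:
  assumes "1 \<le> i'" "i' \<le> r" "1 \<le> j'" "j' \<le> s"
  shows "Phi (w i' j') i j = (if i = i' \<and> j = j' then 1 else 0)"
proof -
  have vi: "v i' \<in> Vr" and vj: "v j' \<in> Vs" using assms by (auto intro: v_in_V_sub)
  have "Phi (w i' j') i j = tform i j (v i') (act (g [^]\<^bsub>G\<^esub> (int n - int i')) (v j'))"
    using assms vi act_int_pow_V_sub[OF s_le vj] by (simp add: v_tensor_def Phi_tens)
  also have "\<dots> = (if i = i' \<and> j = j' then 1 else 0)"
    using assms r_le s_le g_pow_cancel(1)[OF vj] by (auto simp: tform_def coord_v)
  finally show ?thesis .
qed

lemma tens_expand:
  assumes "x \<in> Vr" "y \<in> Vs"
  shows "tens x y = (\<Sum>i=1..r. \<Sum>j=1..s. scT (tform i j x y) (w i j))"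
proof -
  have l1: "linear_on_space sc Vr scT (\<lambda>x. tens x y)" if "y \<in> Vs" for y
    using tens_bilinear that unfolding bilinear_on_spaces_def by blast
  have l2: "linear_on_space sc Vs scT (tens x)" if "x \<in> Vr" for x
    using tens_bilinear that unfolding bilinear_on_spaces_def by blast
  \<comment> \<open>The basis used for the second factor depends on the row: in row i, y is expanded
    in the vectors g^(n-i) v_j.\<close>
  have row: "tens (v i) y = (\<Sum>j=1..s. scT (coord j (act (g [^]\<^bsub>G\<^esub> (int i - int n)) y)) (w i j))"
    if i: "1 \<le> i" "i \<le> r" for i
  proof -
    define y' where "y' = act (g [^]\<^bsub>G\<^esub> (int i - int n)) y"
    have y': "y' \<in> Vs" unfolding y'_def by (intro act_int_pow_V_sub s_le assms)
    have vs_in: "sc c (v j) \<in> Vs" if "j \<in> {1..s}" for c j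
      using that by (intro vs.subspace_scale[OF V_sub_subspace] v_in_V_sub) auto
    have "y = act (g [^]\<^bsub>G\<^esub> (int n - int i)) y'"
      unfolding y'_def using g_pow_cancel(2)[OF assms(2)] by simp
    also have "y' = (\<Sum>j=1..s. sc (coord j y') (v j))"
      by (rule coord_expand_V_sub[OF y' s_le])
    also have "act (g [^]\<^bsub>G\<^esub> (int n - int i)) \<dots> = (\<Sum>j=1..s. act (g [^]\<^bsub>G\<^esub> (int n - int i)) (sc (coord j y') (v j)))"
      by (rule linear_on_space_sum[OF vs.vector_space_axioms V_sub_subspace act_g_pow_linear]) (rule vs_in)
    also have "\<dots> = (\<Sum>j=1..s. sc (coord j y') (act (g [^]\<^bsub>G\<^esub> (int n - int i)) (v j)))"
      using act_g_pow_linear by (intro sum.cong refl) (auto simp: linear_on_space_def v_in_V_sub)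
    finally have y: "y = (\<Sum>j=1..s. sc (coord j y') (act (g [^]\<^bsub>G\<^esub> (int n - int i)) (v j)))" .
    have vi: "v i \<in> Vr" using i by (intro v_in_V_sub)
    have in_Vs: "act (g [^]\<^bsub>G\<^esub> (int n - int i)) (v j) \<in> Vs" if "j \<in> {1..s}" for j
      using that by (intro act_int_pow_V_sub s_le v_in_V_sub) auto
    have "tens (v i) y = (\<Sum>j=1..s. tens (v i) (sc (coord j y') (act (g [^]\<^bsub>G\<^esub> (int n - int i)) (v j))))"
      using in_Vs by (subst (1) y, intro linear_on_space_sum[OF vs.vector_space_axioms V_sub_subspace l2[OF vi]])
        (auto intro!: vs.subspace_scale[OF V_sub_subspace])
    also have "\<dots> = (\<Sum>j=1..s. scT (coord j y') (w i j))"
      using l2[OF vi] in_Vs i by (intro sum.cong refl) (auto simp: linear_on_space_def v_tensor_def)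
    finally show ?thesis unfolding y'_def .
  qed
  have "tens x y = tens (\<Sum>i=1..r. sc (coord i x) (v i)) y"
    using coord_expand_V_sub[OF assms(1) r_le] by simp
  also have "\<dots> = (\<Sum>i=1..r. tens (sc (coord i x) (v i)) y)"
    by (rule linear_on_space_sum[OF vs.vector_space_axioms V_sub_subspace l1[OF assms(2)]])
      (auto intro!: vs.subspace_scale[OF V_sub_subspace] v_in_V_sub)
  also have "\<dots> = (\<Sum>i=1..r. scT (coord i x) (tens (v i) y))"
    using l1[OF assms(2)] by (intro sum.cong refl) (auto simp: linear_on_space_def v_in_V_sub)
  also have "\<dots> = (\<Sum>i=1..r. \<Sum>j=1..s. scT (tform i j x y) (w i j))"
    by (intro sum.cong refl) (auto simp: row vt.scale_sum_right tform_def intro!: sum.cong)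
  finally show ?thesis .
qed

text \<open>If the difference \<open>d\<close> were nonzero, a basis containing it would yield a
  linear form that is 1 at \<open>d\<close>. But \<open>tens_expand\<close> shows that every linear
  form takes the same value on a pure tensor and on its expansion, hence also on \<open>u\<close>
  and its expansion.\<close>

lemma Phi_expand:
  assumes "u \<in> T"
  shows "u = (\<Sum>i=1..r. \<Sum>j=1..s. scT (Phi u i j) (w i j))" (is "u = ?E u")
proof (rule ccontr)
  assume "u \<noteq> ?E u"
  define d where "d = u - ?E u"
  have "d \<noteq> 0" using \<open>u \<noteq> ?E u\<close> by (simp add: d_def)
  define B where "B = vt.extend_basis {d}"
  have ind: "vt.independent {d}" using \<open>d \<noteq> 0\<close> by simp
  have B: "vt.independent B" "vt.span B = UNIV" "d \<in> B"
    unfolding B_def using vt.independent_extend_basis[OF ind] vt.span_extend_basis[OF ind]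
      vt.extend_basis_superset[OF ind] by auto
  define L where "L x = vt.representation B x d" for x
  have L_add: "L (x + y) = L x + L y" and L_scale: "L (scT c x) = c * L x" for x y c
    unfolding L_def using B by (simp_all add: vt.representation_add vt.representation_scale)
  have L_lin: "linear_on_space scT T (*) L" by (simp add: linear_on_space_def L_add L_scale)
  have L_sum: "L (\<Sum>a\<in>A. f a) = (\<Sum>a\<in>A. L (f a))" for A :: "nat set" and f
    by (rule linear_on_space_sum[OF vt.vector_space_axioms vt.subspace_UNIV, where sc' = "(*)"]) (simp_all add: linear_on_space_def L_add L_scale)
  have L_E: "L (?E u) = (\<Sum>i=1..r. \<Sum>j=1..s. Phi u i j * L (w i j))" for u
    by (simp add: L_sum L_scale)
  have "L u = (\<Sum>i=1..r. \<Sum>j=1..s. Phi u i j * L (w i j))"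
    using L_lin _ _ assms
  proof (rule linear_forms_agree)
    show "linear_on_space scT T (*) (\<lambda>u. \<Sum>i=1..r. \<Sum>j=1..s. Phi u i j * L (w i j))"
      unfolding linear_on_space_def
      by (auto simp: Phi_add Phi_scale sum.distrib sum_distrib_left algebra_simps)
    fix x y assume "x \<in> Vr" "y \<in> Vs"
    then show "L (tens x y) = (\<Sum>i=1..r. \<Sum>j=1..s. Phi (tens x y) i j * L (w i j))"
      by (subst tens_expand) (simp_all add: Phi_tens L_sum L_scale)
  qed
  then have "L (?E u + d) = L (?E u)" unfolding L_E d_def by simp
  then have "L d = 0" by (simp add: L_add)
  moreover have "L d = 1" unfolding L_def using B by (simp add: vt.representation_basis)
  ultimately show False by simp
qed

lemma Phi_eqI:
  assumes "u \<in> T" "u' \<in> T" "\<And>i j. 1 \<le> i \<Longrightarrow> i \<le> r \<Longrightarrow> 1 \<le> j \<Longrightarrow> j \<le> s \<Longrightarrow> Phi u i j = Phi u' i j"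
  shows "u = u'"
proof -
  have "u = (\<Sum>i=1..r. \<Sum>j=1..s. scT (Phi u i j) (w i j))" by (rule Phi_expand[OF assms(1)])
  also have "\<dots> = (\<Sum>i=1..r. \<Sum>j=1..s. scT (Phi u' i j) (w i j))"
    by (intro sum.cong refl) (simp add: assms(3))
  also have "\<dots> = u'" by (rule Phi_expand[OF assms(2), symmetric])
  finally show ?thesis .
qed

lemma Phi_surj:
  obtains u where "u \<in> T" "\<And>i j. 1 \<le> i \<Longrightarrow> i \<le> r \<Longrightarrow> 1 \<le> j \<Longrightarrow> j \<le> s \<Longrightarrow> Phi u i j = c i j"
proof
  let ?u = "\<Sum>i=1..r. \<Sum>j=1..s. scT (c i j) (w i j)"
  have mem: "scT (c i j) (w i j) \<in> T" if "i \<in> {1..r}" "j \<in> {1..s}" for i j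
    using that by (intro vt.subspace_scale[OF T_subspace] w_in_T) auto
  show "?u \<in> T"
    by (intro vt.subspace_sum[OF T_subspace] mem)
  fix i j assume ij: "1 \<le> i" "i \<le> r" "1 \<le> j" "j \<le> s"
  have "Phi ?u i j = (\<Sum>i'=1..r. Phi (\<Sum>j'=1..s. scT (c i' j') (w i' j')) i j)"
    by (intro Phi_sum vt.subspace_sum[OF T_subspace] mem)
  also have "\<dots> = (\<Sum>i'=1..r. \<Sum>j'=1..s. Phi (scT (c i' j') (w i' j')) i j)"
    by (intro sum.cong refl Phi_sum mem)
  also have "\<dots> = (\<Sum>i'=1..r. \<Sum>j'=1..s. if i = i' \<and> j = j' then c i j else 0)"
    by (intro sum.cong refl) (simp add: Phi_scale w_in_T Phi_w)
  also have "\<dots> = (\<Sum>i'=1..r. if i = i' then c i j else 0)"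
    using ij by (intro sum.cong refl) (auto simp: sum.delta')
  also have "\<dots> = c i j" using ij by simp
  finally show "Phi ?u i j = c i j" .
qed

section \<open>Powers of g - 1 and the spaces D_d in coordinates\<close>

lemma Phi_N_pow:
  assumes "u \<in> T" "1 \<le> i" "1 \<le> j"
  shows "Phi ((N ^^ m) u) i j = (\<Sum>k\<le>m. of_nat (m choose k) * Phi u (i + k) (j + (m - k)))"
  using binomial_shift_iterate[of "\<lambda>m. Phi ((N ^^ m) u)" 1 i j m] assms
  by (simp add: Phi_N N_pow_closed)

lemma Phi_N_pow_char:
  assumes p: "prime p" "CHAR('f) = p" and u: "u \<in> T" "1 \<le> i" "1 \<le> j"
  shows "Phi ((N ^^ (p ^ e)) u) i j = Phi u (i + p ^ e) j + Phi u i (j + p ^ e)"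
proof -
  have "p ^ e \<noteq> 0" using p prime_gt_0_nat by simp
  have "Phi ((N ^^ (p ^ e)) u) i j = (\<Sum>k\<le>p ^ e. of_nat (p ^ e choose k) * Phi u (i + k) (j + (p ^ e - k)))"
    by (rule Phi_N_pow[OF u])
  also have "\<dots> = (\<Sum>k\<in>{0, p ^ e}. of_nat (p ^ e choose k) * Phi u (i + k) (j + (p ^ e - k)))"
  proof (rule sum.mono_neutral_right)
    show "\<forall>k\<in>{..p ^ e} - {0, p ^ e}. of_nat (p ^ e choose k) * Phi u (i + k) (j + (p ^ e - k)) = 0"
      using char_power_binomial[OF p, of _ e] by auto
  qed auto
  also have "\<dots> = Phi u (i + p ^ e) j + Phi u i (j + p ^ e)"
    using \<open>p ^ e \<noteq> 0\<close> by simp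
  finally show ?thesis .
qed

text \<open>The p^e-th power of g - 1 is again a sum of two index shifts, now by p^e, so the
  binomial theorem is iterated with that step width.\<close>

lemma Phi_N_pow_mult_char:
  assumes p: "prime p" "CHAR('f) = p" and u: "u \<in> T" "1 \<le> i" "1 \<le> j"
  shows "Phi ((N ^^ (m * p ^ e)) u) i j =
    (\<Sum>k\<le>m. of_nat (m choose k) * Phi u (i + k * p ^ e) (j + (m - k) * p ^ e))"
proof -
  have "(N ^^ (m * p ^ e)) u = ((N ^^ (p ^ e)) ^^ m) u"
    by (simp add: funpow_mult mult.commute)
  moreover have "((N ^^ (p ^ e)) ^^ m) u \<in> T" for m
    by (induction m) (auto intro: N_pow_closed u)
  then have "Phi (((N ^^ (p ^ e)) ^^ m) u) i j =
    (\<Sum>k\<le>m. of_nat (m choose k) * Phi u (i + k * p ^ e) (j + (m - k) * p ^ e))"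
    using binomial_shift_iterate[of "\<lambda>m. Phi (((N ^^ (p ^ e)) ^^ m) u)" "p ^ e" i j m] u
    by (simp add: Phi_N_pow_char[OF p])
  ultimately show ?thesis by simp
qed

text \<open>Membership becomes a condition on the support. As each term of \<open>Phi_N_pow\<close>
  raises the index sum by m, the behaviour of D_d under g - 1 is then mere index arithmetic.\<close>

lemma D_space_eq:
  "D_space scT r s w d = {u \<in> T. \<forall>i j. 1 \<le> i \<longrightarrow> 1 \<le> j \<longrightarrow> Phi u i j \<noteq> 0 \<longrightarrow> i + j = d + 1}"
proof (intro equalityI subsetI)
  fix u assume "u \<in> D_space scT r s w d"
  then show "u \<in> {u \<in> T. \<forall>i j. 1 \<le> i \<longrightarrow> 1 \<le> j \<longrightarrow> Phi u i j \<noteq> 0 \<longrightarrow> i + j = d + 1}"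
    unfolding D_space_def
  proof (rule vt.span_induct)
    show "vt.subspace {x. x \<in> {u \<in> T. \<forall>i j. 1 \<le> i \<longrightarrow> 1 \<le> j \<longrightarrow> Phi u i j \<noteq> 0 \<longrightarrow> i + j = d + 1}}"
      unfolding vt.subspace_def
    proof (intro conjI ballI allI)
      show "0 \<in> {x. x \<in> {u \<in> T. \<forall>i j. 1 \<le> i \<longrightarrow> 1 \<le> j \<longrightarrow> Phi u i j \<noteq> 0 \<longrightarrow> i + j = d + 1}}"
        using vt.subspace_0[OF T_subspace] by (simp add: Phi_zero)
    next
      fix x y c
      assume x: "x \<in> {x. x \<in> {u \<in> T. \<forall>i j. 1 \<le> i \<longrightarrow> 1 \<le> j \<longrightarrow> Phi u i j \<noteq> 0 \<longrightarrow> i + j = d + 1}}"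
      then show "scT c x \<in> {x. x \<in> {u \<in> T. \<forall>i j. 1 \<le> i \<longrightarrow> 1 \<le> j \<longrightarrow> Phi u i j \<noteq> 0 \<longrightarrow> i + j = d + 1}}"
        using vt.subspace_scale[OF T_subspace] by (simp add: Phi_scale)
      assume y: "y \<in> {x. x \<in> {u \<in> T. \<forall>i j. 1 \<le> i \<longrightarrow> 1 \<le> j \<longrightarrow> Phi u i j \<noteq> 0 \<longrightarrow> i + j = d + 1}}"
      have "i + j = d + 1" if "1 \<le> i" "1 \<le> j" "Phi (x + y) i j \<noteq> 0" for i j
      proof -
        have "Phi x i j \<noteq> 0 \<or> Phi y i j \<noteq> 0" using that(3) x y by (auto simp: Phi_add)
        then show ?thesis using x y that(1,2) by auto
      qed
      then show "x + y \<in> {x. x \<in> {u \<in> T. \<forall>i j. 1 \<le> i \<longrightarrow> 1 \<le> j \<longrightarrow> Phi u i j \<noteq> 0 \<longrightarrow> i + j = d + 1}}"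
        using x y vt.subspace_add[OF T_subspace] by simp
    qed
    fix x assume "x \<in> {w i j | i j. 1 \<le> i \<and> i \<le> r \<and> 1 \<le> j \<and> j \<le> s \<and> i + j = d + 1}"
    then obtain i j where "1 \<le> i" "i \<le> r" "1 \<le> j" "j \<le> s" "i + j = d + 1" "x = w i j" by blast
    then show "x \<in> {u \<in> T. \<forall>i j. 1 \<le> i \<longrightarrow> 1 \<le> j \<longrightarrow> Phi u i j \<noteq> 0 \<longrightarrow> i + j = d + 1}"
      by (simp add: w_in_T Phi_w)
  qed
next
  fix u assume u: "u \<in> {u \<in> T. \<forall>i j. 1 \<le> i \<longrightarrow> 1 \<le> j \<longrightarrow> Phi u i j \<noteq> 0 \<longrightarrow> i + j = d + 1}"
  have "(\<Sum>i=1..r. \<Sum>j=1..s. scT (Phi u i j) (w i j)) \<in> D_space scT r s w d"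
    unfolding D_space_def
  proof (intro vt.span_sum)
    fix i j assume ij: "i \<in> {1..r}" "j \<in> {1..s}"
    show "scT (Phi u i j) (w i j) \<in> vt.span {w i j | i j. 1 \<le> i \<and> i \<le> r \<and> 1 \<le> j \<and> j \<le> s \<and> i + j = d + 1}"
    proof (cases "Phi u i j = 0")
      case True
      then show ?thesis by (simp add: vt.span_zero)
    next
      case False
      then have "i + j = d + 1" using u ij by auto
      with ij show ?thesis by (intro vt.span_scale vt.span_base) auto
    qed
  qed
  then show "u \<in> D_space scT r s w d" using Phi_expand[of u] u by simp
qed

lemma N_pow_D_space: "(N ^^ m) ` D_space scT r s w (m + d) \<subseteq> D_space scT r s w d"
proof
  fix x assume "x \<in> (N ^^ m) ` D_space scT r s w (m + d)"
  then obtain u where u: "u \<in> D_space scT r s w (m + d)" "x = (N ^^ m) u" by blast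
  have uT: "u \<in> T" and supp: "\<And>i j. 1 \<le> i \<Longrightarrow> 1 \<le> j \<Longrightarrow> Phi u i j \<noteq> 0 \<Longrightarrow> i + j = m + d + 1"
    using u(1) unfolding D_space_eq by blast+
  have "i + j = d + 1" if "1 \<le> i" "1 \<le> j" "Phi x i j \<noteq> 0" for i j
  proof -
    have "(\<Sum>k\<le>m. of_nat (m choose k) * Phi u (i + k) (j + (m - k))) \<noteq> 0"
      using that u(2) Phi_N_pow[OF uT that(1,2)] by simp
    then obtain k where "k \<le> m" "Phi u (i + k) (j + (m - k)) \<noteq> 0"
      by (metis (no_types, lifting) atMost_iff mult_zero_right sum.neutral)
    with supp[of "i + k" "j + (m - k)"] that show ?thesis by simp
  qed
  then show "x \<in> D_space scT r s w d"
    unfolding D_space_eq using u(2) N_pow_closed[OF uT] by blast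
qed

lemma comb_in_T:
  assumes "\<And>m. m \<in> A \<Longrightarrow> I m \<le> r \<and> J m \<le> s"
  shows "(\<Sum>m\<in>A. scT (b m) (w (I m) (J m))) \<in> T"
  using assms by (intro vt.subspace_sum[OF T_subspace] vt.subspace_scale[OF T_subspace] w_in_T) auto

lemma Phi_comb:
  assumes "\<And>m. m \<in> A \<Longrightarrow> 1 \<le> I m \<and> I m \<le> r \<and> 1 \<le> J m \<and> J m \<le> s"
  shows "Phi (\<Sum>m\<in>A. scT (b m) (w (I m) (J m))) i j = (\<Sum>m\<in>A. if i = I m \<and> j = J m then b m else 0)"
proof -
  have "Phi (\<Sum>m\<in>A. scT (b m) (w (I m) (J m))) i j = (\<Sum>m\<in>A. Phi (scT (b m) (w (I m) (J m))) i j)"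
    using assms by (intro Phi_sum vt.subspace_scale[OF T_subspace] w_in_T) auto
  also have "\<dots> = (\<Sum>m\<in>A. if i = I m \<and> j = J m then b m else 0)"
    using assms by (intro sum.cong refl) (auto simp: Phi_scale w_in_T Phi_w)
  finally show ?thesis .
qed

lemma comb_in_D_space:
  assumes "\<And>m. m \<in> A \<Longrightarrow> 1 \<le> I m \<and> I m \<le> r \<and> 1 \<le> J m \<and> J m \<le> s \<and> I m + J m = d + 1"
  shows "scT a (\<Sum>m\<in>A. scT (b m) (w (I m) (J m))) \<in> D_space scT r s w d"
  unfolding D_space_def
  by (intro vt.span_scale vt.span_sum vt.span_base) (use assms in blast)

section \<open>The vectors x_d and the kernel of g - 1\<close>

lemma x_vec_in_T:
  assumes "d \<le> min r s"
  shows "x_vec scT w d \<in> T"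
  unfolding x_vec_def using assms by (intro comb_in_T) auto

lemma Phi_x_vec:
  assumes "d \<le> min r s" "1 \<le> i" "1 \<le> j"
  shows "Phi (x_vec scT w d) i j = (if i + j = d + 1 then (- 1) ^ (i - 1) else 0)"
proof -
  have "Phi (x_vec scT w d) i j = (\<Sum>i'=1..d. if i = i' \<and> j = d + 1 - i' then (- 1) ^ (i' - 1) else 0)"
    unfolding x_vec_def using assms by (intro Phi_comb) auto
  also have "\<dots> = (\<Sum>i'\<in>{1..d}. if i = i' then (if j = d + 1 - i then (- 1) ^ (i - 1) else 0) else 0)"
    by (intro sum.cong refl) auto
  also have "\<dots> = (if i + j = d + 1 then (- 1) ^ (i - 1) else 0)"
    using assms by auto
  finally show ?thesis .
qed

lemma N_x_vec:
  assumes "d \<le> min r s"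
  shows "N (x_vec scT w d) = 0"
proof (rule Phi_eqI)
  fix i j assume ij: "1 \<le> i" "i \<le> r" "1 \<le> j" "j \<le> s"
  then have "(- 1) ^ i = - ((- 1) ^ (i - 1) :: 'f)" by (cases i) auto
  then show "Phi (N (x_vec scT w d)) i j = Phi 0 i j"
    using ij by (simp add: Phi_N x_vec_in_T[OF assms] Phi_x_vec[OF assms] Phi_zero)
qed (use vt.subspace_0[OF T_subspace] in \<open>auto intro: N_closed x_vec_in_T[OF assms]\<close>)

text \<open>Multiplication by \<open>x\<close> in \<open>F[x,y]/(x\<^sup>r,y\<^sup>s)\<close> commutes with \<open>g - 1\<close> and sends \<open>x\<^sub>d\<close> to
  minus \<open>x_vec\<close> of index \<open>d - 1\<close>, so the vectors \<open>x\<^sub>d\<close> in an image of a power of \<open>g - 1\<close> form an initial segment.\<close>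
lemma x_vec_image_mono:
  assumes "(N ^^ m) u = x_vec scT w d'" "u \<in> T" "d \<le> d'" "d' \<le> min r s"
  obtains u' where "u' \<in> T" "(N ^^ m) u' = x_vec scT w d"
proof -
  define e where "e = d' - d"
  obtain u' where u': "u' \<in> T"
    and box: "\<And>i j. 1 \<le> i \<Longrightarrow> i \<le> r \<Longrightarrow> 1 \<le> j \<Longrightarrow> j \<le> s \<Longrightarrow> Phi u' i j = (- 1) ^ e * Phi u (i + e) j"
    by (rule Phi_surj[of "\<lambda>i j. (- 1) ^ e * Phi u (i + e) j"]) blast
  \<comment> \<open>The relation is needed outside the box as well, since \<open>Phi_N_pow\<close>
    evaluates coordinates there; both sides are then 0.\<close>
  have Phi_u': "Phi u' i j = (- 1) ^ e * Phi u (i + e) j" if "1 \<le> i" "1 \<le> j" for i j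
  proof (cases "i \<le> r \<and> j \<le> s")
    case True
    with that box show ?thesis by blast
  next
    case False
    then show ?thesis using Phi_outside[OF u', of i j] Phi_outside[OF assms(2), of "i + e" j] by auto
  qed
  have "(N ^^ m) u' = x_vec scT w d"
  proof (rule Phi_eqI)
    fix i j assume ij: "1 \<le> i" "i \<le> r" "1 \<le> j" "j \<le> s"
    have "Phi ((N ^^ m) u') i j = (- 1) ^ e * Phi ((N ^^ m) u) (i + e) j"
      using ij by (simp add: Phi_N_pow u' assms(2) Phi_u' sum_distrib_left algebra_simps)
    also have "\<dots> = (if i + e + j = d' + 1 then (- 1) ^ e * (- 1) ^ (i + e - 1) else 0)"
      using ij assms(4) by (simp add: assms(1) Phi_x_vec)
    also have "(- 1) ^ e * (- 1) ^ (i + e - 1) = (((- 1) ^ (i - 1)) :: 'f)"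
    proof -
      have "i + e - 1 = (i - 1) + e" using ij by simp
      then show ?thesis by (simp add: power_add mult.left_commute flip: power_mult_distrib)
    qed
    also have "i + e + j = d' + 1 \<longleftrightarrow> i + j = d + 1" using assms(3) by (auto simp: e_def)
    finally show "Phi ((N ^^ m) u') i j = Phi (x_vec scT w d) i j"
      using ij assms(3,4) by (simp add: Phi_x_vec)
  qed (use assms u' in \<open>auto intro: N_pow_closed x_vec_in_T\<close>)
  with u' that show ?thesis by blast
qed

text \<open>For a kernel vector, neighbouring coordinates on an antidiagonal are opposite. Row 1
  therefore determines the whole vector, and \<open>ker_inter_image\<close> may confine its
  conclusion to that row.\<close>

lemma Phi_ker:
  assumes "u \<in> T" "N u = 0" "1 \<le> i" "1 \<le> j"
  shows "Phi u (i + e) j = (- 1) ^ e * Phi u i (j + e)"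
  using assms(3,4)
proof (induction e arbitrary: j)
  case (Suc e)
  have "Phi u (i + e + 1) j + Phi u (i + e) (j + 1) = 0"
    using Phi_N[OF assms(1), of "i + e" j] Suc.prems by (simp add: assms(2) Phi_zero)
  then have "Phi u (i + Suc e) j = - Phi u (i + e) (j + 1)" by (simp add: add_eq_0_iff2)
  with Suc.IH[of "j + 1"] Suc.prems show ?case by simp
qed simp

section \<open>Block sizes of g - 1 from its kernel and the images of its powers\<close>

lemma N_pow_linear: "linear_on_space scT T scT (N ^^ m)"
proof (induction m)
  case 0
  show ?case by (simp add: linear_on_space_def)
next
  case (Suc m)
  then show ?case using N_linear N_pow_closed[of _ m]
    unfolding linear_on_space_def by simp
qed

text \<open>\<open>psi i j\<close> is the coordinate at position i of block j. The listed properties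
  (linearity, g - 1 as a shift of i, vanishing beyond the block length, separation of vectors,
  existence of dual vectors) are all that the two bounds on \<open>lam\<close> take from the
  isomorphism.\<close>

lemma direct_sum_coordinates:
  assumes lam: "\<forall>i\<in>{1..M}. 0 < lam i \<and> lam i \<le> q"
    and iso: "FG_isomorphic G scT T actT
           (\<lambda>c f i. sc c (f i)) (direct_sum M (\<lambda>i. V_sub sc v (lam i))) (\<lambda>h f i. act h (f i))"
  obtains psi :: "nat \<Rightarrow> nat \<Rightarrow> 't \<Rightarrow> 'f"
  where "\<And>i j. linear_on_space scT T (*) (psi i j)"
    and "\<And>i j m u. 1 \<le> i \<Longrightarrow> j \<in> {1..M} \<Longrightarrow> u \<in> T \<Longrightarrow> psi i j ((N ^^ m) u) = psi (i + m) j u"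
    and "\<And>i j u. j \<in> {1..M} \<Longrightarrow> lam j < i \<Longrightarrow> u \<in> T \<Longrightarrow> psi i j u = 0"
    and "\<And>u. u \<in> T \<Longrightarrow> (\<And>i j. 1 \<le> i \<Longrightarrow> j \<in> {1..M} \<Longrightarrow> psi i j u = 0) \<Longrightarrow> u = 0"
    and "\<And>i j. j \<in> {1..M} \<Longrightarrow> 1 \<le> i \<Longrightarrow> i \<le> lam j \<Longrightarrow>
      \<exists>u\<in>T. \<forall>i'\<ge>1. \<forall>j'\<in>{1..M}. psi i' j' u = (if i' = i \<and> j' = j then 1 else 0)"
proof -
  define DS where "DS = direct_sum M (\<lambda>i. V_sub sc v (lam i))"
  obtain \<phi> where bij: "bij_betw \<phi> T DS" and lin: "linear_on_space scT T (\<lambda>c f i. sc c (f i)) \<phi>"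
    and equi: "\<forall>h\<in>carrier G. \<forall>x\<in>T. \<phi> (actT h x) = (\<lambda>i. act h (\<phi> x i))"
    using iso unfolding FG_isomorphic_def DS_def by blast
  have mem: "\<phi> u j \<in> V_sub sc v (lam j)" if "u \<in> T" "j \<in> {1..M}" for u j
    using bij_betwE[OF bij] that unfolding DS_def direct_sum_def by blast
  have mem_q: "\<phi> u j \<in> V_sub sc v q" if "u \<in> T" for u j
  proof (cases "j \<in> {1..M}")
    case True
    then show ?thesis using mem[OF that True] lam V_sub_mono[of "lam j" q] by blast
  next
    case False
    then have "\<phi> u j = 0" using bij_betwE[OF bij] that unfolding DS_def direct_sum_def by blast
    then show ?thesis using vs.subspace_0[OF V_sub_subspace] by simp
  qed
  have add: "\<phi> (u + u') j = \<phi> u j + \<phi> u' j" and scale: "\<phi> (scT c u) j = sc c (\<phi> u j)"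
    if "u \<in> T" "u' \<in> T" for u u' c j
    using lin that unfolding linear_on_space_def by (auto simp: plus_fun_def)
  have diff: "\<phi> (u - u') j = \<phi> u j - \<phi> u' j" if "u \<in> T" "u' \<in> T" for u u' j
    by (rule linear_on_space_diff[where f = "\<lambda>u. \<phi> u j", OF vt.vector_space_axioms vs.vector_space_axioms T_subspace])
      (use that add scale in \<open>auto simp: linear_on_space_def\<close>)
  have N: "\<phi> (N u) j = act g (\<phi> u j) - \<phi> u j" if "u \<in> T" for u j
    using equi g that by (simp add: N_def diff actT_g_closed)
  have N_pow: "\<phi> ((N ^^ m) u) j = g_minus_1_pow act g m (\<phi> u j)" if "u \<in> T" for u j m
  proof (induction m)
    case (Suc m)
    then show ?case using N[OF N_pow_closed[OF that, of m]] by (simp add: g_minus_1_pow_def)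
  qed (simp add: g_minus_1_pow_def)
  define psi where "psi i j u = coord i (\<phi> u j)" for i j u
  show ?thesis
  proof (rule that[of psi])
    show "linear_on_space scT T (*) (psi i j)" for i j
      unfolding linear_on_space_def psi_def by (auto simp: add scale coord_add coord_scale mem_q)
    show "psi i j ((N ^^ m) u) = psi (i + m) j u" if "1 \<le> i" "j \<in> {1..M}" "u \<in> T" for i j m u
      using that by (simp add: psi_def N_pow coord_g_minus_1_pow mem_q)
    show "psi i j u = 0" if "j \<in> {1..M}" "lam j < i" "u \<in> T" for i j u
      using mem[OF that(3,1)] mem_V_sub_iff[of "lam j"] lam that unfolding psi_def by blast
    show "u = 0" if u: "u \<in> T" and 0: "\<And>i j. 1 \<le> i \<Longrightarrow> j \<in> {1..M} \<Longrightarrow> psi i j u = 0" for u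
    proof -
      have "\<phi> u j = 0" for j
      proof (cases "j \<in> {1..M}")
        case True
        then show ?thesis using 0 by (intro coord_eq_0 mem_q u) (auto simp: psi_def)
      next
        case False
        then show ?thesis using bij_betwE[OF bij] u unfolding DS_def direct_sum_def by blast
      qed
      then have "\<phi> u j = \<phi> (u - u) j" for j using diff[OF u u, of j] by simp
      then have "\<phi> u = \<phi> (u - u)" by (rule ext)
      then have "u = u - u"
        using bij u vt.subspace_diff[OF T_subspace u u] unfolding bij_betw_def inj_on_def by blast
      then show "u = 0" by simp
    qed
    show "\<exists>u\<in>T. \<forall>i'\<ge>1. \<forall>j'\<in>{1..M}. psi i' j' u = (if i' = i \<and> j' = j then 1 else 0)"
      if "j \<in> {1..M}" "1 \<le> i" "i \<le> lam j" for i j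
    proof -
      define E where "E j' = (if j' = j then v i else 0)" for j'
      have "E \<in> DS"
        using that vs.subspace_0[OF V_sub_subspace] unfolding DS_def direct_sum_def E_def
        by (auto intro: v_in_V_sub)
      then obtain u where u: "u \<in> T" "\<phi> u = E"
        using bij unfolding bij_betw_def by blast
      have "i \<le> q" using lam that by (meson le_trans)
      then have "psi i' j' u = (if i' = i \<and> j' = j then 1 else 0)" for i' j'
        using that by (auto simp: psi_def u(2) E_def coord_v coord_0)
      with u show ?thesis by blast
    qed
  qed
qed

context
  fixes M :: nat and lam :: "nat \<Rightarrow> nat"
  assumes lam: "\<forall>i\<in>{1..M}. 0 < lam i \<and> lam i \<le> q" and mono: "antimono_on {1..M} lam"
    and iso: "FG_isomorphic G scT T actT
           (\<lambda>c f i. sc c (f i)) (direct_sum M (\<lambda>i. V_sub sc v (lam i))) (\<lambda>h f i. act h (f i))"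
begin

text \<open>If \<open>lam l\<close> were at most m, only blocks before the l-th could exceed length
  m. A vector in the kernel and in the image of the m-th power is then determined by l - 1 numbers
  \<open>psi 1 j\<close>. The l vectors x_1, ..., x_l are of this kind, so some nontrivial
  combination of them vanishes, although they are independent.\<close>

lemma lam_lower_bound:
  assumes l: "1 \<le> l" "l \<le> M" "l \<le> min r s"
    and im: "\<And>d. 1 \<le> d \<Longrightarrow> d \<le> l \<Longrightarrow> \<exists>u\<in>T. (N ^^ m) u = x_vec scT w d"
  shows "m < lam l"
proof (rule ccontr)
  assume "\<not> m < lam l"
  obtain psi :: "nat \<Rightarrow> nat \<Rightarrow> 't \<Rightarrow> 'f" where psi:
    "\<And>i j. linear_on_space scT T (*) (psi i j)"
    "\<And>i j m u. 1 \<le> i \<Longrightarrow> j \<in> {1..M} \<Longrightarrow> u \<in> T \<Longrightarrow> psi i j ((N ^^ m) u) = psi (i + m) j u"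
    "\<And>i j u. j \<in> {1..M} \<Longrightarrow> lam j < i \<Longrightarrow> u \<in> T \<Longrightarrow> psi i j u = 0"
    "\<And>u. u \<in> T \<Longrightarrow> (\<And>i j. 1 \<le> i \<Longrightarrow> j \<in> {1..M} \<Longrightarrow> psi i j u = 0) \<Longrightarrow> u = 0"
    by (rule direct_sum_coordinates[OF lam iso]) blast
  have "\<forall>i. \<exists>u. i < l \<longrightarrow> u \<in> T \<and> (N ^^ m) u = x_vec scT w (i + 1)"
    using im by (metis Suc_eq_plus1 Suc_leI le_add2)
  then obtain U where U: "\<And>i. i < l \<Longrightarrow> U i \<in> T" "\<And>i. i < l \<Longrightarrow> (N ^^ m) (U i) = x_vec scT w (i + 1)"
    by metis
  have "l - 1 < l" using l by simp
  then obtain c where c: "\<exists>i<l. c i \<noteq> 0"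
    "\<And>j. j < l - 1 \<Longrightarrow> (\<Sum>i<l. c i * psi 1 (j + 1) (x_vec scT w (i + 1))) = 0"
    by (rule homogeneous_system_solvable[where b = "\<lambda>i j. psi 1 (j + 1) (x_vec scT w (i + 1))"]) blast
  define u where "u = (\<Sum>i<l. scT (c i) (U i))"
  define x where "x = (\<Sum>i<l. scT (c i) (x_vec scT w (i + 1)))"
  have cU: "scT (c i) (U i) \<in> T" if "i \<in> {..<l}" for i
    using that U by (auto intro: vt.subspace_scale[OF T_subspace])
  have x_in: "x_vec scT w (i + 1) \<in> T" if "i < l" for i
    using that l by (intro x_vec_in_T) auto
  have cx: "scT (c i) (x_vec scT w (i + 1)) \<in> T" if "i \<in> {..<l}" for i
    using that by (auto intro!: vt.subspace_scale[OF T_subspace] x_in[simplified])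
  have uT: "u \<in> T" unfolding u_def by (rule vt.subspace_sum[OF T_subspace cU])
  have xT: "x \<in> T" unfolding x_def by (rule vt.subspace_sum[OF T_subspace cx])
  have Nu: "(N ^^ m) u = x"
  proof -
    have "(N ^^ m) u = (\<Sum>i<l. (N ^^ m) (scT (c i) (U i)))"
      unfolding u_def by (rule linear_on_space_sum[OF vt.vector_space_axioms T_subspace N_pow_linear cU])
    also have "\<dots> = x"
      unfolding x_def using N_pow_linear[of m] U by (intro sum.cong refl) (simp add: linear_on_space_def)
    finally show ?thesis .
  qed
  have Nx: "N x = 0"
  proof -
    have "N x = (\<Sum>i<l. N (scT (c i) (x_vec scT w (i + 1))))"
      unfolding x_def by (rule linear_on_space_sum[OF vt.vector_space_axioms T_subspace N_linear cx])
    also have "\<dots> = (\<Sum>i<l. scT (c i) (N (x_vec scT w (i + 1))))"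
      using N_linear x_in by (intro sum.cong refl) (simp add: linear_on_space_def)
    also have "\<dots> = 0" using N_x_vec l by (intro sum.neutral) auto
    finally show ?thesis .
  qed
  have "x = 0"
  proof (rule psi(4)[OF xT])
    fix i j :: nat assume ij: "1 \<le> i" "j \<in> {1..M}"
    \<comment> \<open>The coefficients \<open>c\<close> settle the first case. In the second,
      position i is position i - 1 of N x = 0. In the third, x is the image of u under the m-th
      power, and position i + m lies beyond block j.\<close>
    consider "j < l" "i = 1" | "i \<ge> 2" | "l \<le> j" using ij(1) by linarith
    then show "psi i j x = 0"
    proof cases
      case 1
      have "psi 1 j x = (\<Sum>i<l. psi 1 j (scT (c i) (x_vec scT w (i + 1))))"
        unfolding x_def by (rule linear_on_space_sum[OF vt.vector_space_axioms T_subspace psi(1) cx])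
      also have "\<dots> = (\<Sum>i<l. c i * psi 1 (j - 1 + 1) (x_vec scT w (i + 1)))"
        using psi(1) x_in ij by (intro sum.cong refl) (simp add: linear_on_space_def)
      also have "\<dots> = 0" using 1 ij by (intro c(2)) auto
      finally show ?thesis using 1 by simp
    next
      case 2
      then have "psi i j x = psi (i - 1) j ((N ^^ 1) x)"
        using ij xT by (subst psi(2)) auto
      also have "\<dots> = psi (i - 1) j (0 :: 't)" by (simp add: Nx)
      also have "\<dots> = 0"
        by (rule linear_on_space_0[OF vt.vector_space_axioms T_subspace psi(1)])
      finally show ?thesis .
    next
      case 3
      have "lam j \<le> lam l" using mono l ij(2) 3 by (intro monotone_onD[OF mono]) auto
      then have "lam j < i + m" using ij \<open>\<not> m < lam l\<close> by simp
      then show ?thesis using psi(2)[OF ij uT, of m] psi(3)[OF ij(2) _ uT] Nu by simp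
    qed
  qed
  \<comment> \<open>In row 1 the vector x_d has its only nonzero coordinate, 1, in column d, so row
    1 of x displays the coefficients.\<close>
  have "c i = 0" if "i < l" for i
  proof -
    have "Phi x 1 (i + 1) = (\<Sum>i'<l. Phi (scT (c i') (x_vec scT w (i' + 1))) 1 (i + 1))"
      unfolding x_def by (rule Phi_sum[OF cx])
    also have "\<dots> = (\<Sum>i'<l. if i' = i then c i' else 0)"
      using x_in l by (intro sum.cong refl) (auto simp: Phi_scale Phi_x_vec[unfolded One_nat_def])
    also have "\<dots> = c i" using that by simp
    finally show ?thesis by (simp add: \<open>x = 0\<close> Phi_zero)
  qed
  with c(1) show False by blast
qed

text \<open>If \<open>lam l\<close> exceeded m, each of the first l blocks would contribute a vector
  of the kernel that is an m-th image. By assumption row 1 of such vectors has at most l0 < l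
  nonzero entries. Some nontrivial combination therefore has row 1 equal to zero and vanishes by
  \<open>Phi_ker\<close>, contradicting independence across blocks.\<close>

lemma lam_upper_bound:
  assumes l: "l0 < l" "l \<le> M"
    and ker: "\<And>u d. u \<in> T \<Longrightarrow> N ((N ^^ m) u) = 0 \<Longrightarrow> l0 < d \<Longrightarrow> Phi ((N ^^ m) u) 1 d = 0"
  shows "lam l \<le> m"
proof (rule ccontr)
  assume "\<not> lam l \<le> m"
  obtain psi :: "nat \<Rightarrow> nat \<Rightarrow> 't \<Rightarrow> 'f" where psi:
    "\<And>i j. linear_on_space scT T (*) (psi i j)"
    "\<And>i j m u. 1 \<le> i \<Longrightarrow> j \<in> {1..M} \<Longrightarrow> u \<in> T \<Longrightarrow> psi i j ((N ^^ m) u) = psi (i + m) j u"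
    "\<And>u. u \<in> T \<Longrightarrow> (\<And>i j. 1 \<le> i \<Longrightarrow> j \<in> {1..M} \<Longrightarrow> psi i j u = 0) \<Longrightarrow> u = 0"
    "\<And>i j. j \<in> {1..M} \<Longrightarrow> 1 \<le> i \<Longrightarrow> i \<le> lam j \<Longrightarrow>
      \<exists>u\<in>T. \<forall>i'\<ge>1. \<forall>j'\<in>{1..M}. psi i' j' u = (if i' = i \<and> j' = j then 1 else 0)"
    by (rule direct_sum_coordinates[OF lam iso]) blast
  have lam_gt: "m + 1 \<le> lam (i + 1)" if "i < l" for i
  proof -
    have "lam l \<le> lam (i + 1)" using l that by (intro monotone_onD[OF mono]) auto
    with \<open>\<not> lam l \<le> m\<close> show ?thesis by simp
  qed
  \<comment> \<open>The basis vector at position m + 1 of block i + 1, which the m-th power moves to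
    position 1.\<close>
  have "\<exists>u. i < l \<longrightarrow> u \<in> T \<and> (\<forall>i'\<ge>1. \<forall>j'\<in>{1..M}. psi i' j' u = (if i' = m + 1 \<and> j' = i + 1 then 1 else 0))" for i
  proof (cases "i < l")
    case True
    then have "i + 1 \<in> {1..M}" using l by simp
    from psi(4)[OF this _ lam_gt[OF True]] show ?thesis by auto
  qed auto
  then obtain U where U: "\<And>i. i < l \<Longrightarrow> U i \<in> T"
    "\<And>i i' j'. i < l \<Longrightarrow> 1 \<le> i' \<Longrightarrow> j' \<in> {1..M} \<Longrightarrow> psi i' j' (U i) = (if i' = m + 1 \<and> j' = i + 1 then 1 else 0)"
    by metis
  obtain c where c: "\<exists>i<l. c i \<noteq> 0"
    "\<And>j. j < l0 \<Longrightarrow> (\<Sum>i<l. c i * Phi ((N ^^ m) (U i)) 1 (j + 1)) = 0"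
    by (rule homogeneous_system_solvable[OF l(1), where b = "\<lambda>i j. Phi ((N ^^ m) (U i)) 1 (j + 1)"]) blast
  define u where "u = (\<Sum>i<l. scT (c i) (U i))"
  have cU: "scT (c i) (U i) \<in> T" if "i \<in> {..<l}" for i
    using that U by (auto intro: vt.subspace_scale[OF T_subspace])
  have uT: "u \<in> T" unfolding u_def by (rule vt.subspace_sum[OF T_subspace cU])
  have psi_u: "psi i j u = (\<Sum>k<l. if i = m + 1 \<and> j = k + 1 then c k else 0)" if "1 \<le> i" "j \<in> {1..M}" for i j
  proof -
    have "psi i j u = (\<Sum>k<l. psi i j (scT (c k) (U k)))"
      unfolding u_def by (rule linear_on_space_sum[OF vt.vector_space_axioms T_subspace psi(1) cU])
    also have "\<dots> = (\<Sum>k<l. c k * psi i j (U k))"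
      using psi(1)[of i j] U(1) by (intro sum.cong refl) (simp add: linear_on_space_def)
    also have "\<dots> = (\<Sum>k<l. if i = m + 1 \<and> j = k + 1 then c k else 0)"
      using U(2) that by (intro sum.cong refl) simp
    finally show ?thesis .
  qed
  define x where "x = (N ^^ m) u"
  have xT: "x \<in> T" unfolding x_def by (rule N_pow_closed[OF uT])
  have Nx: "N x = 0"
  proof (rule psi(3)[OF N_closed[OF xT]])
    fix i j :: nat assume ij: "1 \<le> i" "j \<in> {1..M}"
    have "N x = (N ^^ Suc m) u" by (simp add: x_def)
    then have "psi i j (N x) = psi (i + Suc m) j u"
      using psi(2)[OF ij uT, of "Suc m"] by simp
    also have "\<dots> = 0" using ij by (subst psi_u) auto
    finally show "psi i j (N x) = 0" .
  qed
  have Phi_x1: "Phi x 1 d = 0" if "1 \<le> d" for d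
  proof (cases "d \<le> l0")
    case True
    have "x = (\<Sum>i<l. (N ^^ m) (scT (c i) (U i)))"
      unfolding x_def u_def by (rule linear_on_space_sum[OF vt.vector_space_axioms T_subspace N_pow_linear cU])
    also have "Phi \<dots> 1 d = (\<Sum>i<l. Phi ((N ^^ m) (scT (c i) (U i))) 1 d)"
      by (intro Phi_sum N_pow_closed cU)
    also have "\<dots> = (\<Sum>i<l. c i * Phi ((N ^^ m) (U i)) 1 (d - 1 + 1))"
      using N_pow_linear[of m] U(1) that
      by (intro sum.cong refl) (simp add: linear_on_space_def Phi_scale N_pow_closed)
    also have "\<dots> = 0" using True that by (intro c(2)) auto
    finally show ?thesis .
  next
    case False
    then show ?thesis using ker[OF uT, of d] Nx unfolding x_def by simp
  qed
  have "x = 0"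
  proof (rule Phi_eqI[OF xT vt.subspace_0[OF T_subspace]])
    fix i j :: nat assume "1 \<le> i" "i \<le> r" "1 \<le> j" "j \<le> s"
    then show "Phi x i j = Phi 0 i j"
      using Phi_ker[OF xT Nx, of 1 j "i - 1"] Phi_x1[of "j + (i - 1)"] by (simp add: Phi_zero)
  qed
  have "c k = 0" if "k < l" for k
  proof -
    have k: "k + 1 \<in> {1..M}" using that l by simp
    have "psi 1 (k + 1) x = psi (1 + m) (k + 1) u"
      unfolding x_def using psi(2)[OF _ k uT, of 1 m] by simp
    also have "\<dots> = (\<Sum>k'<l. if k = k' then c k' else 0)"
      using k by (subst psi_u) (auto intro!: sum.cong)
    also have "\<dots> = c k" using that by simp
    finally show ?thesis
      using linear_on_space_0[OF vt.vector_space_axioms T_subspace psi(1)] \<open>x = 0\<close> by simp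
  qed
  with c(1) show False by blast
qed

end

section \<open>The vectors z and y\<close>

text \<open>Here \<open>P\<close> is p^n, not the matrix, and \<open>K\<close> is R + S + 1 - k, the
  reflection of k in the interval from S + 1 to R; the sign exponent R + S - k becomes K -
  1.\<close>

definition zvec :: "nat \<Rightarrow> nat \<Rightarrow> nat \<Rightarrow> 't" where
  "zvec P t K = scT ((- 1) ^ (K - 1)) (\<Sum>i=0..t. scT ((- 1) ^ i) (w (i * P + K) ((t - i + 1) * P)))"

text \<open>For 1 <= K <= R these are all positions (iP + K, jP) of the box with i + j = rn + sn -
  t. There are t + 1 of them, as many as there are positions in z, which is why the system for zeta
  is square.\<close>

definition yvec :: "nat \<Rightarrow> nat \<Rightarrow> nat \<Rightarrow> nat \<Rightarrow> nat \<Rightarrow> 't" where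
  "yvec P rn sn t K = scT ((- 1) ^ (K - 1))
     (\<Sum>i=0..t. scT (zeta_mat rn sn t $$ (i, 0)) (w ((rn - t + i) * P + K) ((sn - i) * P)))"

context
  fixes p rn sn R S t P :: nat
  assumes p: "prime p" "CHAR('f) = p" and P: "P = p ^ n"
    and r_eq: "r = rn * P + R" and s_eq: "s = sn * P + S"
    and SR: "S < R" and RP: "R < P"
    and t_rn: "t \<le> rn" and t_sn: "t < sn" and lt_p: "rn + sn - t < p"
begin

lemma P_pos: "P > 0"
  using RP by simp

lemma minus_1_pow_P: "(- 1) ^ P = (- 1 :: 'f)"
  unfolding P by (rule char_power_minus_1[OF p])

lemma z_box:
  assumes "1 \<le> K" "K \<le> R" "i \<in> {0..t}"
  shows "1 \<le> i * P + K \<and> i * P + K \<le> r \<and> 1 \<le> (t - i + 1) * P \<and> (t - i + 1) * P \<le> s"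
proof -
  have "i * P \<le> rn * P" "(t - i + 1) * P \<le> sn * P"
    using assms(3) t_rn t_sn by (auto intro!: mult_le_mono1 simp del: mult_Suc)
  moreover have "1 * P \<le> (t - i + 1) * P" by (rule mult_le_mono1) simp
  ultimately show ?thesis using assms P_pos unfolding r_eq s_eq by linarith
qed

lemma y_box:
  assumes "1 \<le> K" "K \<le> R" "i \<in> {0..t}"
  shows "1 \<le> (rn - t + i) * P + K \<and> (rn - t + i) * P + K \<le> r \<and> 1 \<le> (sn - i) * P \<and> (sn - i) * P \<le> s"
proof -
  have "(rn - t + i) * P \<le> rn * P" "(sn - i) * P \<le> sn * P" "1 * P \<le> (sn - i) * P"
    using assms(3) t_rn t_sn by (auto intro!: mult_le_mono1 simp del: mult_Suc nat_mult_1)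
  then show ?thesis using assms P_pos unfolding r_eq s_eq by linarith
qed

lemma zvec_in_T: "1 \<le> K \<Longrightarrow> K \<le> R \<Longrightarrow> zvec P t K \<in> T"
  unfolding zvec_def by (intro vt.subspace_scale[OF T_subspace] comb_in_T) (use z_box in blast)

lemma yvec_in_T: "1 \<le> K \<Longrightarrow> K \<le> R \<Longrightarrow> yvec P rn sn t K \<in> T"
  unfolding yvec_def by (intro vt.subspace_scale[OF T_subspace] comb_in_T) (use y_box in blast)

lemma Phi_zvec:
  assumes "1 \<le> K" "K \<le> R"
  shows "Phi (zvec P t K) i j =
    (- 1) ^ (K - 1) * (\<Sum>m=0..t. if i = m * P + K \<and> j = (t - m + 1) * P then (- 1) ^ m else 0)"
proof -
  have "(\<Sum>i=0..t. scT ((- 1) ^ i) (w (i * P + K) ((t - i + 1) * P))) \<in> T"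
    by (intro comb_in_T) (use z_box[OF assms] in blast)
  then have "Phi (zvec P t K) i j =
    (- 1) ^ (K - 1) * Phi (\<Sum>i=0..t. scT ((- 1) ^ i) (w (i * P + K) ((t - i + 1) * P))) i j"
    unfolding zvec_def by (rule Phi_scale)
  also have "Phi (\<Sum>i=0..t. scT ((- 1) ^ i) (w (i * P + K) ((t - i + 1) * P))) i j =
    (\<Sum>m=0..t. if i = m * P + K \<and> j = (t - m + 1) * P then (- 1) ^ m else 0)"
    by (rule Phi_comb) (rule z_box[OF assms])
  finally show ?thesis .
qed

lemma Phi_yvec:
  assumes "1 \<le> K" "K \<le> R"
  shows "Phi (yvec P rn sn t K) i j = (- 1) ^ (K - 1) *
    (\<Sum>m=0..t. if i = (rn - t + m) * P + K \<and> j = (sn - m) * P then zeta_mat rn sn t $$ (m, 0) else 0)"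
proof -
  let ?c = "\<Sum>i=0..t. scT (zeta_mat rn sn t $$ (i, 0)) (w ((rn - t + i) * P + K) ((sn - i) * P))"
  have "?c \<in> T"
    by (intro comb_in_T) (use y_box[OF assms] in blast)
  then have "Phi (yvec P rn sn t K) i j = (- 1) ^ (K - 1) * Phi ?c i j"
    unfolding yvec_def by (rule Phi_scale)
  also have "Phi ?c i j =
    (\<Sum>m=0..t. if i = (rn - t + m) * P + K \<and> j = (sn - m) * P then zeta_mat rn sn t $$ (m, 0) else 0)"
    by (rule Phi_comb) (rule y_box[OF assms])
  finally show ?thesis .
qed

lemma x_index_le:
  assumes "K \<le> R"
  shows "t * P + K \<le> min r s"
proof -
  have "t * P \<le> rn * P" "(t + 1) * P \<le> sn * P"
    using t_rn t_sn by (intro mult_le_mono1; simp)+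
  then have "t * P + K \<le> r" "t * P + K \<le> s"
    using assms RP unfolding r_eq s_eq add_mult_distrib nat_mult_1 by linarith+
  then show ?thesis by simp
qed

lemma split_index: "m \<le> t \<Longrightarrow> m * P + (t - m + 1) * P = (t + 1) * P"
  by (simp flip: add_mult_distrib)

text \<open>All coefficients of the (P-1)-st power are signs. Summand m of z spreads over the first
  indices from (m-1)P + K + 1 to mP + K; these segments, the one for m = 0 cut off at 1, tile the
  antidiagonal of x_(tP+K), so every coordinate receives exactly one contribution.\<close>

lemma N_pow_zvec:
  assumes K: "1 \<le> K" "K \<le> R"
  shows "(N ^^ (P - 1)) (zvec P t K) = x_vec scT w (t * P + K)"
proof (rule Phi_eqI)
  show "(N ^^ (P - 1)) (zvec P t K) \<in> T" by (intro N_pow_closed zvec_in_T K)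
  show "x_vec scT w (t * P + K) \<in> T" by (intro x_vec_in_T x_index_le K)
  fix i j assume ij: "1 \<le> i" "i \<le> r" "1 \<le> j" "j \<le> s"
  let ?a = "(- 1) ^ (K - 1) :: 'f"
  let ?C = "\<lambda>q m. i + q = m * P + K \<and> j + (P - 1 - q) = (t - m + 1) * P"
  have "Phi ((N ^^ (P - 1)) (zvec P t K)) i j =
    (\<Sum>q\<le>P - 1. of_nat (P - 1 choose q) * Phi (zvec P t K) (i + q) (j + (P - 1 - q)))"
    by (rule Phi_N_pow[OF zvec_in_T[OF K] ij(1,3)])
  also have "\<dots> = (\<Sum>q\<le>P - 1. (- 1) ^ q * (?a * (\<Sum>m=0..t. if ?C q m then (- 1) ^ m else 0)))"
  proof (intro sum.cong refl)
    fix q assume "q \<in> {..P - 1}"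
    then have "q < P" using P_pos by auto
    then have "q < p ^ n" by (simp only: P)
    then have "of_nat (P - 1 choose q) = ((- 1) ^ q :: 'f)"
      unfolding P by (rule char_power_pred_binomial[OF p])
    then show "of_nat (P - 1 choose q) * Phi (zvec P t K) (i + q) (j + (P - 1 - q)) =
        (- 1) ^ q * (?a * (\<Sum>m=0..t. if ?C q m then (- 1) ^ m else 0))"
      by (simp only: Phi_zvec[OF K])
  qed
  also have "\<dots> = (\<Sum>q\<le>P - 1. \<Sum>m=0..t. if ?C q m then (- 1) ^ q * (?a * (- 1) ^ m) else 0)"
    by (intro sum.cong refl) (simp only: sum_distrib_left if_distrib mult_zero_right)
  also have "\<dots> = Phi (x_vec scT w (t * P + K)) i j"
  proof (cases "i + j = t * P + K + 1")
    case False
    have "\<not> ?C q m" if "q \<le> P - 1" "m \<le> t" for q m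
    proof
      assume "?C q m"
      have "i + j + (P - 1) = (i + q) + (j + (P - 1 - q))" using that by simp
      also have "\<dots> = m * P + (t - m + 1) * P + K" using \<open>?C q m\<close> by (simp only: add_ac)
      also have "\<dots> = t * P + P + K" using split_index[OF that(2)] by simp
      finally show False using False P_pos by simp
    qed
    then have "(\<Sum>q\<le>P - 1. \<Sum>m=0..t. if ?C q m then (- 1) ^ q * (?a * (- 1) ^ m) else 0) = (0 :: 'f)"
      by (intro sum.neutral ballI if_not_P) auto
    then show ?thesis using False ij by (simp only: Phi_x_vec[OF x_index_le[OF K(2)]] if_False)
  next
    case True
    \<comment> \<open>\<open>m0\<close> is (i - K)/P rounded up, with P - 1 added first so that no
      subtraction is truncated; \<open>q0\<close> is the resulting gap m0 P + K - i.\<close>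
    define m0 where "m0 = (i + P - 1 - K) div P"
    define x where "x = (i + P - 1 - K) mod P"
    define q0 where "q0 = P - 1 - x"
    have xP: "x < P" using P_pos by (simp add: x_def)
    have "m0 * P + x = i + P - 1 - K" by (simp add: m0_def x_def)
    then have m0: "i + q0 = m0 * P + K" and q0: "q0 \<le> P - 1"
      using xP ij(1) K RP unfolding q0_def by linarith+
    have "i \<le> t * P + K" using True ij(3) by simp
    then have "i + P - 1 - K < (t + 1) * P" using K RP by (simp add: algebra_simps)
    then have "m0 \<le> t" unfolding m0_def by (metis less_mult_imp_div_less less_Suc_eq_le Suc_eq_plus1)
    have C: "?C q m \<longleftrightarrow> q = q0 \<and> m = m0" if "q \<le> P - 1" "m \<le> t" for q m
    proof
      assume "?C q m"
      then have "m * P + q0 = m0 * P + q" using m0 by linarith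
      moreover have "q < P" "q0 < P" using that(1) q0 P_pos by auto
      ultimately show "q = q0 \<and> m = m0" using mult_add_unique by blast
    next
      assume eq: "q = q0 \<and> m = m0"
      have "j + (P - 1 - q0) + (i + q0) = t * P + P + K" using True q0 P_pos by simp
      also have "\<dots> = (t - m0 + 1) * P + (m0 * P + K)" using split_index[OF \<open>m0 \<le> t\<close>] by simp
      finally have "j + (P - 1 - q0) = (t - m0 + 1) * P" unfolding m0 by simp
      with eq m0 show "?C q m" by blast
    qed
    have "(\<Sum>q\<le>P - 1. \<Sum>m=0..t. if ?C q m then (- 1) ^ q * (?a * (- 1) ^ m) else 0) =
      (\<Sum>q\<le>P - 1. \<Sum>m=0..t. if m = m0 then (if q = q0 then (- 1) ^ q0 * (?a * (- 1) ^ m0) else 0) else 0)"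
    proof (intro sum.cong refl)
      fix q m assume "q \<in> {..P - 1}" "m \<in> {0..t}"
      then have "?C q m \<longleftrightarrow> q = q0 \<and> m = m0" by (intro C) auto
      then show "(if ?C q m then (- 1) ^ q * (?a * (- 1) ^ m) else 0) =
        (if m = m0 then (if q = q0 then (- 1) ^ q0 * (?a * (- 1) ^ m0) else 0) else 0)"
        by (simp only:) auto
    qed
    also have "\<dots> = (- 1) ^ q0 * (?a * (- 1) ^ m0)"
      using \<open>m0 \<le> t\<close> q0 by simp
    also have "\<dots> = (- 1) ^ (i - 1)"
    proof -
      \<comment> \<open>The exponents add up to m0 P + K - 1, and (-1)^P = -1 in F holds for p = 2
        too, so the total sign is that of x_d.\<close>
      have "(- 1) ^ (i - 1) * (- 1) ^ q0 = ((- 1) ^ (i - 1 + q0) :: 'f)" by (simp only: power_add)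
      also have "i - 1 + q0 = P * m0 + (K - 1)" using m0 ij(1) K(1) by (simp add: mult.commute)
      also have "(- 1) ^ (P * m0 + (K - 1)) = ((- 1) ^ m0 * ?a)"
        by (simp only: power_add power_mult minus_1_pow_P)
      finally have "(- 1) ^ q0 * (?a * (- 1) ^ m0) = (- 1) ^ (i - 1) * (((- 1) ^ q0 * (- 1) ^ q0) :: 'f)"
        by (simp only: mult_ac)
      also have "(- 1) ^ q0 * (- 1) ^ q0 = (1 :: 'f)" by (simp flip: power_mult_distrib)
      finally show ?thesis by simp
    qed
    finally show ?thesis using True ij by (simp add: Phi_x_vec[OF x_index_le[OF K(2)]])
  qed
  finally show "Phi ((N ^^ (P - 1)) (zvec P t K)) i j = Phi (x_vec scT w (t * P + K)) i j" .
qed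

lemma mult_add_less_mult:
  assumes "i + x * P = m * P + K" "K < P" "1 \<le> i"
  shows "x \<le> m \<and> i = (m - x) * P + K"
proof -
  have "\<not> m < x"
  proof
    assume "m < x"
    then have "(m + 1) * P \<le> x * P" by (intro mult_le_mono1) simp
    with assms show False by simp
  qed
  then have "m * P = (m - x) * P + x * P" by (simp flip: add_mult_distrib)
  with assms \<open>\<not> m < x\<close> show ?thesis by simp
qed

text \<open>The exponent is a multiple of P, so indices move in steps of P and keep their residues.
  Only the t + 1 block positions of z can be reached, and the value at position m1 is row m1 of P
  times zeta.\<close>

lemma N_pow_yvec:
  assumes K: "1 \<le> K" "K \<le> R"
  shows "(N ^^ ((rn + sn - 2 * t - 1) * P)) (yvec P rn sn t K) = zvec P t K"
proof (rule Phi_eqI)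
  let ?c = "rn + sn - 2 * t - 1"
  let ?a = "(- 1) ^ (K - 1) :: 'f"
  let ?zeta = "\<lambda>m. zeta_mat rn sn t $$ (m, 0) :: 'f"
  show "(N ^^ (?c * P)) (yvec P rn sn t K) \<in> T" by (intro N_pow_closed yvec_in_T K)
  show "zvec P t K \<in> T" by (intro zvec_in_T K)
  fix i j assume ij: "1 \<le> i" "i \<le> r" "1 \<le> j" "j \<le> s"
  have KP: "K < P" using K RP by simp
  have step: "Phi ((N ^^ (?c * P)) (yvec P rn sn t K)) i j =
    (\<Sum>q\<le>?c. of_nat (?c choose q) * Phi (yvec P rn sn t K) (i + q * P) (j + (?c - q) * P))"
    by (rule Phi_N_pow_mult_char[OF p yvec_in_T[OF K] ij(1,3), where e = n, folded P])
  show "Phi ((N ^^ (?c * P)) (yvec P rn sn t K)) i j = Phi (zvec P t K) i j"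
  proof (cases "\<exists>m1\<le>t. i = m1 * P + K \<and> j = (t - m1 + 1) * P")
    case True
    then obtain m1 where m1: "m1 \<le> t" "i = m1 * P + K" "j = (t - m1 + 1) * P" by blast
    \<comment> \<open>Coordinates of y by block row. At block row rn - t + m the block column t + 1
      + ?c - i' becomes sn - m, so \<open>h\<close> is supported on t + 1 consecutive rows.\<close>
    define h where "h i' = Phi (yvec P rn sn t K) (i' * P + K) ((t + 1 + ?c - i') * P)" for i'
    have h_val: "h (rn - t + m) = ?a * ?zeta m" if "m \<le> t" for m
    proof -
      have "t + 1 + ?c - (rn - t + m) = sn - m" using that t_rn t_sn by simp
      then have "h (rn - t + m) = ?a * (\<Sum>m'=0..t. if m' = m then ?zeta m' else 0)"
        unfolding h_def Phi_yvec[OF K] using P_pos by (intro arg_cong[where f = "(*) ?a"] sum.cong) auto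
      then show ?thesis using that by simp
    qed
    have h_0: "h i' = 0" if "i' \<notin> {rn - t..<rn - t + (t + 1)}" for i'
    proof -
      have "i' * P + K \<noteq> (rn - t + m) * P + K" if "m \<in> {0..t}" for m
        using that \<open>i' \<notin> {rn - t..<rn - t + (t + 1)}\<close> P_pos by auto
      then show ?thesis unfolding h_def Phi_yvec[OF K] by (subst sum.neutral) auto
    qed
    have "Phi ((N ^^ (?c * P)) (yvec P rn sn t K)) i j = (\<Sum>q\<le>?c. of_nat (?c choose q) * h (m1 + q))"
      unfolding step
    proof (intro sum.cong refl)
      fix q assume q: "q \<in> {..?c}"
      have "i + q * P = (m1 + q) * P + K" unfolding m1(2) by (simp add: add_mult_distrib)
      moreover have "t - m1 + 1 + (?c - q) = t + 1 + ?c - (m1 + q)" using m1(1) q by simp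
      then have "j + (?c - q) * P = (t + 1 + ?c - (m1 + q)) * P"
        unfolding m1(3) by (simp only: add_mult_distrib[symmetric])
      ultimately show "of_nat (?c choose q) * Phi (yvec P rn sn t K) (i + q * P) (j + (?c - q) * P) =
          of_nat (?c choose q) * h (m1 + q)" by (simp only: h_def)
    qed
    also have "\<dots> = (\<Sum>j<t + 1. binom_F ?c (int (rn - t) + int j - int m1) * h (rn - t + j))"
      by (rule binomial_sum_support[OF h_0])
    also have "\<dots> = ?a * (\<Sum>j\<le>t. binom_F ?c (int rn - int t + int j - int m1) * ?zeta j)"
      unfolding sum_distrib_left
    proof (intro sum.cong)
      fix j assume "j \<in> {..t}"
      then have "h (rn - t + j) = ?a * ?zeta j" by (intro h_val) simp
      moreover have "int (rn - t) = int rn - int t" using t_rn by (rule of_nat_diff)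
      ultimately show "binom_F ?c (int (rn - t) + int j - int m1) * h (rn - t + j) =
          ?a * (binom_F ?c (int rn - int t + int j - int m1) * ?zeta j)"
        by (simp only: mult_ac)
    qed auto
    also have "(\<Sum>j\<le>t. binom_F ?c (int rn - int t + int j - int m1) * ?zeta j) = (- 1) ^ m1"
      by (rule P_mat_zeta) (use t_rn t_sn lt_p p m1 in auto)
    also have "?a * (- 1) ^ m1 = Phi (zvec P t K) i j"
    proof -
      have "(\<Sum>m=0..t. if i = m * P + K \<and> j = (t - m + 1) * P then (- 1) ^ m else 0) =
        (\<Sum>m=0..t. if m = m1 then (- 1) ^ m else (0::'f))"
        unfolding m1 using P_pos by (intro sum.cong refl) auto
      also have "\<dots> = (- 1) ^ m1" using m1(1) by simp
      finally show ?thesis by (simp only: Phi_zvec[OF K])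
    qed
    finally show ?thesis .
  next
    case False
    have "Phi (zvec P t K) i j = 0"
      unfolding Phi_zvec[OF K] using False by (auto intro!: sum.neutral)
    moreover have "Phi (yvec P rn sn t K) (i + q * P) (j + (?c - q) * P) = 0" if q: "q \<le> ?c" for q
    proof -
      have "\<not> (i + q * P = (rn - t + m) * P + K \<and> j + (?c - q) * P = (sn - m) * P)" if m: "m \<in> {0..t}" for m
      proof
        assume eq: "i + q * P = (rn - t + m) * P + K \<and> j + (?c - q) * P = (sn - m) * P"
        define m1 where "m1 = rn - t + m - q"
        have 1: "q \<le> rn - t + m" "i = m1 * P + K"
          using mult_add_less_mult[where i = i and x = q and m = "rn - t + m" and K = K] eq KP ij(1) by (auto simp: m1_def)
        have 2: "?c - q \<le> sn - m" "j = (sn - m - (?c - q)) * P"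
          using mult_add_less_mult[where i = j and x = "?c - q" and m = "sn - m" and K = 0] eq P_pos ij(3) by auto
        \<comment> \<open>A contribution would put (i, j) at block row m1 and block column t - m1 +
          1. Since j is positive, that column is at least 1, so m1 is at most t and (i, j) would be
          a position of z.\<close>
        have "sn - m - (?c - q) \<noteq> 0" using 2(2) ij(3) by auto
        then have "m1 \<le> t" "sn - m - (?c - q) = t - m1 + 1"
          using 1(1) 2(1) m t_rn t_sn q unfolding m1_def by auto
        with 1(2) 2(2) False show False by auto
      qed
      then show ?thesis unfolding Phi_yvec[OF K] mult_eq_0_iff
        by (intro disjI2 sum.neutral ballI if_not_P)
    qed
    then have "Phi ((N ^^ (?c * P)) (yvec P rn sn t K)) i j = 0" unfolding step by (auto intro!: sum.neutral)
    ultimately show ?thesis by simp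
  qed
qed

text \<open>The equations \<open>c \<in> ker (g - 1)\<close> and \<open>c = (g - 1)^(\<dots>) u\<close> are read off along the coordinates
  \<open>(1 + \<delta> + mp\<^sup>n, (t - m)p\<^sup>n + S + 1)\<close>: adding neighbouring ones gives a homogeneous system whose
  matrix is \<open>P_mat\<close> with \<open>t - 1\<close> in place of \<open>t\<close>.\<close>
lemma ker_inter_image:
  assumes u: "u \<in> T" and ker: "N ((N ^^ ((rn + sn - 2 * t) * P)) u) = 0" and d: "t * P + S < d"
  shows "Phi ((N ^^ ((rn + sn - 2 * t) * P)) u) 1 d = 0"
proof -
  let ?A = "rn + sn - 2 * t"
  define c where "c = (N ^^ (?A * P)) u"
  have cT: "c \<in> T" unfolding c_def by (rule N_pow_closed[OF u])
  define e where "e = d - (t * P + S + 1)"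
  have d_eq: "d = t * P + S + 1 + e" using d by (simp add: e_def)
  \<comment> \<open>All these positions satisfy i + j = d + 1 and lie P apart, so kernel membership
    makes \<open>f\<close> alternate by (-1)^P = -1.\<close>
  define f where "f m = Phi c (1 + (e + m * P)) ((t - m) * P + S + 1)" for m
  define h where "h i = Phi u (1 + e + i * P) ((t + ?A - i) * P + S + 1)" for i
  have f_ker: "f m = (- 1) ^ m * f 0" if "m \<le> t" for m
  proof -
    have idx: "(t - m') * P + S + 1 + (e + m' * P) = d" if "m' \<le> t" for m'
    proof -
      have "(t - m') * P + m' * P = t * P" using that by (simp flip: add_mult_distrib)
      then show ?thesis using d_eq by simp
    qed
    have f': "f m' = (- 1) ^ (e + m' * P) * Phi c 1 d" if "m' \<le> t" for m'
      using Phi_ker[OF cT, of 1 "(t - m') * P + S + 1" "e + m' * P"] ker idx[OF that]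
      unfolding f_def c_def by simp
    have "(- 1) ^ (m * P) = (((- 1) ^ m) :: 'f)"
      by (metis minus_1_pow_P mult.commute power_mult)
    then show ?thesis using f'[OF that] f'[of 0] by (simp add: power_add)
  qed
  have f_sum: "f m = (\<Sum>q\<le>?A. of_nat (?A choose q) * h (m + q))" if "m \<le> t" for m
  proof -
    have "f m = (\<Sum>q\<le>?A. of_nat (?A choose q) *
        Phi u (1 + (e + m * P) + q * P) ((t - m) * P + S + 1 + (?A - q) * P))"
      unfolding f_def c_def P by (rule Phi_N_pow_mult_char[OF p u]) auto
    also have "\<dots> = (\<Sum>q\<le>?A. of_nat (?A choose q) * h (m + q))"
    proof (intro sum.cong refl)
      fix q assume "q \<in> {..?A}"
      then have "t - m + (?A - q) = t + ?A - (m + q)" using that by simp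
      then have "(t - m) * P + (?A - q) * P = (t + ?A - (m + q)) * P"
        by (simp only: add_mult_distrib[symmetric])
      then have "(t - m) * P + S + 1 + (?A - q) * P = (t + ?A - (m + q)) * P + S + 1" by simp
      moreover have "1 + (e + m * P) + q * P = 1 + e + (m + q) * P" by (simp add: add_mult_distrib)
      ultimately show "of_nat (?A choose q) * Phi u (1 + (e + m * P) + q * P) ((t - m) * P + S + 1 + (?A - q) * P) =
        of_nat (?A choose q) * h (m + q)" by (simp only: h_def)
    qed
    finally show ?thesis .
  qed
  \<comment> \<open>Only t unknowns survive: up to block row rn - t the second index is at least sn
    P + S + 1 > s, and beyond block row rn the first index exceeds r because R < P.\<close>
  define lo where "lo = rn - t + 1"
  have h_0: "h i = 0" if "i \<notin> {lo..<lo + t}" for i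
  proof -
    have "i \<le> rn - t \<or> rn < i" using that t_rn by (auto simp: lo_def)
    then consider "i \<le> rn - t" | "rn < i" by blast
    then show ?thesis
    proof cases
      case 1
      then have "sn \<le> t + ?A - i" using t_rn t_sn by simp
      then have "sn * P \<le> (t + ?A - i) * P" by (rule mult_le_mono1)
      then have "s < (t + ?A - i) * P + S + 1" unfolding s_eq by linarith
      then show ?thesis unfolding h_def by (intro Phi_outside[OF u]) linarith
    next
      case 2
      then have "(rn + 1) * P \<le> i * P" by (intro mult_le_mono1) simp
      then show ?thesis unfolding h_def using RP by (intro Phi_outside[OF u]) (simp add: r_eq)
    qed
  qed
  have sums: "(\<Sum>j<t. binom_F (?A + 1) (int lo + int j - int m) * h (lo + j)) = 0" if "m < t" for m
  proof -
    \<comment> \<open>Adding neighbours eliminates the unknown value \<open>f 0\<close> and leaves t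
      homogeneous equations for the t unknowns.\<close>
    have "0 = f (m + 1) + f m" using f_ker[of m] f_ker[of "m + 1"] that by simp
    also have "\<dots> = (\<Sum>q\<le>?A + 1. of_nat (?A + 1 choose q) * h (m + q))"
      using sum_binomial_Suc[of ?A "\<lambda>q. h (m + q)"] f_sum[of m] f_sum[of "m + 1"] that by simp
    also have "\<dots> = (\<Sum>j<t. binom_F (?A + 1) (int lo + int j - int m) * h (lo + j))"
      by (rule binomial_sum_support[OF h_0])
    finally show ?thesis by simp
  qed
  have A1: "?A + 1 = lo + (sn - t)" using t_rn t_sn by (simp add: lo_def)
  \<comment> \<open>The left side is rn + sn - t + 1, so the strict inequality
    \<open>rn + sn - t < p\<close> is used in full here.\<close>
  have bound: "lo + (sn - t) + t \<le> CHAR('f)"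
    using t_rn t_sn lt_p p by (simp add: lo_def)
  have "h (lo + i) = 0" if "i < t" for i
    by (rule binomial_toeplitz_inj[OF bound _ that]) (use sums A1 in simp)
  then have "h i = 0" for i using h_0[of i] by (cases "i \<in> {lo..<lo + t}") (auto simp: le_iff_add)
  then have "f 0 = 0" using f_sum[of 0] by simp
  moreover have "f 0 = (- 1) ^ e * Phi c 1 d"
    using Phi_ker[OF cT, of 1 "t * P + S + 1" e] ker d_eq unfolding f_def c_def by simp
  ultimately show ?thesis unfolding c_def by simp
qed

text \<open>The single choice K = R serves the lower bound for every \<open>l\<close> in the range:
  it puts x_(tP+R) in the image, and \<open>x_vec_image_mono\<close> passes to all smaller
  indices.\<close>

lemma lam_eq:
  assumes lam: "\<forall>i\<in>{1..min r s}. 0 < lam i \<and> lam i \<le> q" "antimono_on {1..min r s} lam"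
    and iso: "FG_isomorphic G scT T actT
           (\<lambda>c f i. sc c (f i)) (direct_sum (min r s) (\<lambda>i. V_sub sc v (lam i))) (\<lambda>h f i. act h (f i))"
    and l: "t * P + S < l" "l \<le> t * P + R"
  shows "lam l = (rn + sn - 2 * t) * P"
proof (rule antisym)
  have l_le: "l \<le> min r s" using l(2) x_index_le[of R] by simp
  show "lam l \<le> (rn + sn - 2 * t) * P"
    by (rule lam_upper_bound[OF lam iso l(1) l_le]) (rule ker_inter_image)
  have "(rn + sn - 2 * t) * P - 1 < lam l"
  proof (rule lam_lower_bound[OF lam iso])
    show "1 \<le> l" "l \<le> min r s" "l \<le> min r s" using l l_le by auto
    fix d assume "1 \<le> d" "d \<le> l"
    have R: "1 \<le> R" "R \<le> R" using SR by auto
    \<comment> \<open>The exponent splits as (P - 1) + (rn + sn - 2t - 1)P, the powers that lead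
      from y to z and from z to x.\<close>
    have "rn + sn - 2 * t = Suc (rn + sn - 2 * t - 1)" using t_rn t_sn by simp
    then have "(rn + sn - 2 * t) * P = P + (rn + sn - 2 * t - 1) * P" by (metis mult_Suc)
    then have "(rn + sn - 2 * t) * P - 1 = (P - 1) + (rn + sn - 2 * t - 1) * P"
      using P_pos by simp
    then have "(N ^^ ((rn + sn - 2 * t) * P - 1)) (yvec P rn sn t R) = x_vec scT w (t * P + R)"
      by (simp only: funpow_add o_apply N_pow_yvec[OF R] N_pow_zvec[OF R])
    then obtain u where "u \<in> T" "(N ^^ ((rn + sn - 2 * t) * P - 1)) u = x_vec scT w d"
      by (rule x_vec_image_mono[OF _ yvec_in_T[OF R], where d = d])
        (use \<open>d \<le> l\<close> l(2) x_index_le[of R] in auto)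
    then show "\<exists>u\<in>T. (N ^^ ((rn + sn - 2 * t) * P - 1)) u = x_vec scT w d" by blast
  qed
  then show "(rn + sn - 2 * t) * P \<le> lam l" by simp
qed

lemma zvec_in_D_space:
  assumes "1 \<le> K" "K \<le> R"
  shows "zvec P t K \<in> D_space scT r s w ((t + 1) * P + (K - 1))"
  unfolding zvec_def
proof (rule comb_in_D_space)
  fix i assume i: "i \<in> {0..t}"
  then show "1 \<le> i * P + K \<and> i * P + K \<le> r \<and> 1 \<le> (t - i + 1) * P \<and> (t - i + 1) * P \<le> s \<and>
      i * P + K + (t - i + 1) * P = (t + 1) * P + (K - 1) + 1"
    using z_box[OF assms i] split_index[of i] assms(1) by simp
qed

lemma yvec_in_D_space:
  assumes "1 \<le> K" "K \<le> R"
  shows "yvec P rn sn t K \<in> D_space scT r s w ((rn + sn - t) * P + (K - 1))"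
  unfolding yvec_def
proof (rule comb_in_D_space)
  fix i assume i: "i \<in> {0..t}"
  have "(rn - t + i) * P + (sn - i) * P = (rn + sn - t) * P"
    using i t_rn t_sn by (simp flip: add_mult_distrib)
  then show "1 \<le> (rn - t + i) * P + K \<and> (rn - t + i) * P + K \<le> r \<and> 1 \<le> (sn - i) * P \<and> (sn - i) * P \<le> s \<and>
      (rn - t + i) * P + K + (sn - i) * P = (rn + sn - t) * P + (K - 1) + 1"
    using y_box[OF assms i] assms(1) by simp
qed

lemma N_pow_D_space_block:
  "(N ^^ ((rn + sn - 2 * t - 1) * P)) ` D_space scT r s w ((rn + sn - t) * P + x)
    \<subseteq> D_space scT r s w ((t + 1) * P + x)"
proof -
  have "rn + sn - 2 * t - 1 + (t + 1) = rn + sn - t" using t_rn t_sn by simp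
  then have "(rn + sn - 2 * t - 1) * P + (t + 1) * P = (rn + sn - t) * P"
    by (simp only: add_mult_distrib[symmetric])
  then show ?thesis
    using N_pow_D_space[of "(rn + sn - 2 * t - 1) * P" "(t + 1) * P + x"] by (simp only: add.assoc[symmetric])
qed

end

end

theorem proposition5:
  fixes p a q n r s rn sn R S l t k :: nat
    and G :: "('g, 'c) monoid_scheme" and g :: 'g
    and sc :: "'f::field \<Rightarrow> 'v::ab_group_add \<Rightarrow> 'v"
    and act :: "'g \<Rightarrow> 'v \<Rightarrow> 'v" and v :: "nat \<Rightarrow> 'v"
    and scT :: "'f \<Rightarrow> 't::ab_group_add \<Rightarrow> 't"
    and actT :: "'g \<Rightarrow> 't \<Rightarrow> 't" and T :: "'t set" and tens :: "'v \<Rightarrow> 'v \<Rightarrow> 't"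
    and lam :: "nat \<Rightarrow> nat" and w :: "nat \<Rightarrow> nat \<Rightarrow> 't" and z y :: 't
  assumes "prime p" and "CHAR('f) = p" and "a > 0" and "q = p ^ a"
    and "group G" and "g \<in> carrier G" and "generate G {g} = carrier G" and "card (carrier G) = q"
    and "is_Vq G g q sc act v"
    and "1 \<le> r" and "r \<le> q" and "1 \<le> s" and "s \<le> q"
    and "is_tensor_module G sc act (V_sub sc v r) (V_sub sc v s) scT actT T tens"
    and "\<forall>i\<in>{1..min r s}. 0 < lam i \<and> lam i \<le> q"
    and "antimono_on {1..min r s} lam"
    and "FG_isomorphic G scT T actT
           (\<lambda>c f i. sc c (f i)) (direct_sum (min r s) (\<lambda>i. V_sub sc v (lam i))) (\<lambda>h f i. act h (f i))"
    and "p ^ n \<le> max r s" and "max r s < p ^ (n + 1)"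
    and "r = rn * p ^ n + R" and "rn < p" and "R < p ^ n"
    and "s = sn * p ^ n + S" and "sn < p" and "S < p ^ n"
    and "w = v_tensor G g n act v tens"
    and "l = t * p ^ n + k" and "1 \<le> k" and "k \<le> p ^ n"
    and "max (int r + int s - int p ^ (n + 1)) 0 + 1 \<le> int l" and "l \<le> min r s"
    and "min R S > 0"
    and "R > S" and "S + 1 \<le> k" and "k \<le> R"
    and "int t \<le> min (int rn) (int sn - 1)"
    and "z = scT ((- 1) ^ (R + S - k))
               (\<Sum>i=0..t. scT ((- 1) ^ i) (w (i * p ^ n + R + S + 1 - k) ((t - i + 1) * p ^ n)))"
    and "y = scT ((- 1) ^ (R + S - k))
               (\<Sum>i=0..t. scT (zeta_mat rn sn t $$ (i, 0))
                  (w ((rn - t + i) * p ^ n + R + S + 1 - k) ((sn - i) * p ^ n)))"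
  shows "lam l = (rn + sn - 2 * t) * p ^ n
    \<and> g_minus_1_pow actT g ((rn + sn - 2 * t - 1) * p ^ n)
        ` D_space scT r s w ((rn + sn - t) * p ^ n + R + S - k)
        \<subseteq> D_space scT r s w ((t + 1) * p ^ n + R + S - k)
    \<and> (z \<in> D_space scT r s w ((t + 1) * p ^ n + R + S - k)
       \<and> g_minus_1_pow actT g (p ^ n - 1) z = x_vec scT w (t * p ^ n + R + S + 1 - k))
    \<and> (invertible_mat (P_mat rn sn t :: 'f mat)
       \<and> y \<in> D_space scT r s w ((rn + sn - t) * p ^ n + R + S - k)
       \<and> g_minus_1_pow actT g ((rn + sn - 2 * t - 1) * p ^ n) y = z)"
proof -
  define K where "K = R + S + 1 - k"
  have "q > 0" using assms(1,4) by (simp add: prime_gt_0_nat)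
  interpret tensor_module G g q sc act v r s n scT actT T tens
    by (intro tensor_module.intro Vq_module.intro tensor_module_axioms.intro)
      (rule assms(5,6,8,9,11,13,14) | fact \<open>q > 0\<close>)+
  have K: "1 \<le> K" "K \<le> R" and RSk: "R + S - k = K - 1"
    using assms(33,34,35) by (auto simp: K_def)
  have t: "t \<le> rn" "t < sn" using assms(36) by auto
  have lt_p: "rn + sn - t < p"
  proof -
    have "int r + int s - int p ^ (n + 1) + 1 \<le> int l" using assms(30) by linarith
    then have "int (r + s + 1) \<le> int (l + p ^ (n + 1))" by simp
    then have "r + s + 1 \<le> l + p ^ (n + 1)" by (simp only: of_nat_le_iff)
    moreover have "(rn + sn) * p ^ n + R + S = r + s" "(t + p) * p ^ n + k = l + p ^ (n + 1)"
      unfolding assms(20,23,27) by (simp_all add: add_mult_distrib)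
    ultimately have "(rn + sn) * p ^ n < (t + p) * p ^ n"
      using assms(35) by linarith
    then have "rn + sn < t + p" by simp
    then show ?thesis using assms(1) prime_gt_0_nat[of p] by linarith
  qed
  note ctx = assms(1,2) refl assms(20,23,33,22) t lt_p
  \<comment> \<open>No truncation occurs since k is at most R and S + 1 at most k; thus R + S - k =
    K - 1 can be split off.\<close>
  have idx: "x * p ^ n + R + S + 1 - k = x * p ^ n + K" "x * p ^ n + R + S - k = x * p ^ n + (K - 1)" for x
    using assms(34,35) by (auto simp: K_def)
  have z: "z = zvec (p ^ n) t K" and y: "y = yvec (p ^ n) rn sn t K"
    unfolding zvec_def yvec_def assms(26,37,38) RSk idx by (rule refl)+
  have "rn + sn - t \<le> CHAR('f)" using lt_p assms(2) by simp
  then have "invertible_mat (P_mat rn sn t :: 'f mat)"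
    by (rule P_mat_invertible[OF t])
  moreover have "lam l = (rn + sn - 2 * t) * p ^ n"
    by (rule lam_eq[OF ctx assms(15,16,17)]) (use assms(27,34,35) in auto)
  ultimately show ?thesis
    unfolding g_minus_1_pow_N assms(26) idx z y
    using N_pow_D_space_block[OF ctx] zvec_in_D_space[OF ctx K] N_pow_zvec[OF ctx K]
      yvec_in_D_space[OF ctx K] N_pow_yvec[OF ctx K]
    by (intro conjI)
qed

end
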